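(* Let $k\ge 2$ and let $\Gamma$ be a $k$-cube group with adjacency structure $E_1,\ldots,E_k$ (equivalently, a $k$-dimensional cube complex with one vertex and adjacency structure $E_1,\ldots,E_k$, regarded as a $k$-cube group). Then its adjacency matrices $M_1,\ldots,M_k$ commute pairwise and satisfy the Unique Common Extension Property.
   Context: **$k$-cube groups.** Let $k\ge 2$ and let $E_1,\ldots,E_k$ be finite sets with $|E_i|=2m_i$, $m_i\ge 2$, each endowed with a fixed-point-free involution $a\mapsto a^{-1}$. For $i\ne j$ put $F(i,j)=E_i\times E_j\times E_i\times E_j$, let $R\subseteq\bigsqcup_{i\neq j}F(i,j)$, $R(i,j):=R\cap F(i,j)$, and $\Gamma=\langle E_1\sqcup\cdots\sqcup E_k \mid aba'b'=1 \text{ for } (a,b,a',b')\in R\rangle$, where the symbol $a^{-1}$ is the inverse of $a$ in $\Gamma$. $R(i,j)$ is identified with $R(j,i)$ via $(a,b,a',b')\mapsto((b')^{-1},(a')^{-1},b^{-1},a^{-1})$. Conditions: C1: for each $(a,b,a',b')\in R$, each of $(a^{-1},(b')^{-1},(a')^{-1},b^{-1})$, $(a',b',a,b)$, $((a')^{-1},b^{-1},a^{-1},(b')^{-1})$ is in $R$, and the four 4-tuples are distinct. C2: for all $i\ne j$, each projection of $R(i,j)$ onto a subproduct of the form $E_i\times E_j$ or $E_j\times E_i$ is bijective. C3: for every $p\in\{1,\ldots,k\}$, $n\in\{2,\ldots,k\}$, $J\subseteq\{1,\ldots,k\}\setminus\{p\}$ with $|J|=n-1$, and every choice of $n-1$ elements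 $(u,v_j,u^j,w_j)\in R(p,j)$, $j\in J$ (with common $u\in E_p$), there are unique elements $u^L\in E_p$ ($L\subseteq J$) and $v_i^L,w_i^L\in E_i$ ($L\subseteq J$, $i\in J\setminus L$) extending the given ones ($u^\emptyset=u$, $u^{\{j\}}=u^j$, $v_j^\emptyset=v_j$, $w_j^\emptyset=w_j$) such that for all $L\subseteq J$ with $0\le|L|\le n-2$: (a) $(u^L,v_j^L,u^{L\cup\{j\}},w_j^L)\in R(p,j)$ for $j\in J\setminus L$; (b) $((v_i^L)^{-1},v_j^L,(w_i^{L\cup\{j\}})^{-1},w_j^{L\cup\{i\}})\in R(i,j)$ for $i\neq j$ in $J\setminus L$; (c) $(w_i^L,(w_j^L)^{-1},v_i^{L\cup\{j\}},(v_j^{L\cup\{i\}})^{-1})\in R(i,j)$ for $i\ne j$ in $J\setminus L$. $\Gamma$ is a $k$-cube group with adjacency structure $E_1,\ldots,E_k$ if C1, C2 hold and, when $k\ge 3$, also C3. **Pointed $k$-cubes.** Fix $p$ and $J=\{1,\ldots,k\}\setminus\{p\}$. A pointed $k$-cube $\square(u,v_J,u^J,w_J)$ is the system of all $u^L,v_i^L,w_i^L$ determined as in C3 by elements $(u,v_j,u^j,w_j)\in R(p,j)$, $j\in J$ (it labels the edges of a based oriented $k$-dimensional cube; different $p$ give the same set up to canonical identification). $\mathcal{S}_k=\mathcal{S}_k(\Gamma)$ is the set of pointed $k$-cubes. **Adjacency matrices.** $M_1,\ldots,M_k$ are the $\{0,1\}$-matrices indexed by $\mathcal{S}_k$ defined,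 for $A=\square(u,v_J,u^J,w_J)$ and $B=\square(x,y_J,x^J,z_J)$, by: - $M_p(A,B)=1$ iff for all $L\subseteq J$: $u^L\ne(x^L)^{-1}$, and for all $j\in J\setminus L$, $v_j^L=(z_j^L)^{-1}$ if $|L|$ is even and $w_j^L=(y_j^L)^{-1}$ if $|L|$ is odd. (That is, the face of $B$ through its basepoint transverse to direction $p$ equals the opposite such face of $A$, and $B$ is not the reflection of $A$ in that face.) - for $i\ne p$, $M_i(A,B)=1$ iff for all $L\subseteq J\setminus\{i\}$: $(x^L)^{-1}=u^{L\cup\{i\}}$; $(y_j^L)^{-1}=w_j^{L\cup\{i\}}$ and $(z_j^L)^{-1}=v_j^{L\cup\{i\}}$ for all $j\in J\setminus(L\cup\{i\})$; and $v_i^L\neq(y_i^L)^{-1}$, $w_i^L\ne(z_i^L)^{-1}$. **Unique Common Extension Property.** For $k\ge3$: for all distinct $p,q,r\in\{1,\ldots,k\}$ and all $A,B_p,B_q,B_r\in\mathcal{S}_k$ with $M_p(A,B_p)=M_q(A,B_q)=M_r(A,B_r)=1$, there are unique $C_{pq},C_{pr},C_{qr},D\in\mathcal{S}_k$ such that $M_p(B_q,C_{pq})$, $M_p(B_r,C_{pr})$, $M_q(B_p,C_{pq})$, $M_q(B_r,C_{qr})$, $M_r(B_p,C_{pr})$, $M_r(B_q,C_{qr})$, $M_p(C_{qr},D)$, $M_q(C_{pr},D)$, $M_r(C_{pq},D)$ all equal $1$. For $k=2$: for all $A,B,C\in\mathcal{S}_2$ with $M_1(A,B)=M_2(A,C)=1$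 there is a unique $D\in\mathcal{S}_2$ with $M_2(B,D)=M_1(C,D)=1$. *)

theory Defs
  imports "HOL-Algebra.Group" "HOL-Library.FuncSet"
begin

section \<open>Presented groups\<close>

text \<open>
  Congruence on the words over an alphabet \<open>X\<close> generated by setting every word of \<open>Q\<close> equal to the
  empty word. There are no formal inverses: the relators have to make each letter invertible.
\<close>

inductive word_cong :: "'g set \<Rightarrow> 'g list set \<Rightarrow> 'g list \<Rightarrow> 'g list \<Rightarrow> bool"
  for X :: "'g set" and Q :: "'g list set" where
  refl: "x \<in> lists X \<Longrightarrow> word_cong X Q x x"
| sym: "word_cong X Q x y \<Longrightarrow> word_cong X Q y x"
| trans: "word_cong X Q x y \<Longrightarrow> word_cong X Q y z \<Longrightarrow> word_cong X Q x z"
| relator: "x \<in> lists X \<Longrightarrow> y \<in> lists X \<Longrightarrow> r \<in> Q \<Longrightarrow> r \<in> lists X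
    \<Longrightarrow> word_cong X Q (x @ r @ y) (x @ y)"

definition word_class :: "'g set \<Rightarrow> 'g list set \<Rightarrow> 'g list \<Rightarrow> 'g list set" where
  "word_class X Q x = {y. word_cong X Q x y}"

definition presented :: "'g set \<Rightarrow> 'g list set \<Rightarrow> 'g list set monoid" where
  "presented X Q = \<lparr>carrier = word_class X Q ` lists X,
     mult = (\<lambda>C D. {z. \<exists>x\<in>C. \<exists>y\<in>D. word_cong X Q (x @ y) z}),
     one = word_class X Q []\<rparr>"

lemma word_cong_lists: "word_cong X Q x y \<Longrightarrow> x \<in> lists X \<and> y \<in> lists X"
  by (induction rule: word_cong.induct) auto

lemma word_cong_context:
  assumes "word_cong X Q x y" "s \<in> lists X" "t \<in> lists X"
  shows "word_cong X Q (s @ x @ t) (s @ y @ t)"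
  using assms(1)
proof (induction rule: word_cong.induct)
  case (refl x)
  with assms(2,3) have "s @ x @ t \<in> lists X" by simp
  then show ?case by (rule word_cong.refl)
next
  case (sym x y)
  then show ?case by (blast intro: word_cong.sym)
next
  case (trans x y z)
  then show ?case by (blast intro: word_cong.trans)
next
  case (relator x y r)
  with assms(2,3) have "s @ x \<in> lists X" "y @ t \<in> lists X" by simp_all
  from word_cong.relator[OF this relator(3,4)] show ?case by simp
qed

lemma word_cong_append:
  assumes "word_cong X Q x x'" "word_cong X Q y y'"
  shows "word_cong X Q (x @ y) (x' @ y')"
proof -
  have "word_cong X Q (x @ y) (x' @ y)"
    using word_cong_context[OF assms(1), of "[]" y] word_cong_lists[OF assms(2)] by simp
  moreover have "word_cong X Q (x' @ y) (x' @ y')"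
    using word_cong_context[OF assms(2), of x' "[]"] word_cong_lists[OF assms(1)] by simp
  ultimately show ?thesis by (rule word_cong.trans)
qed

lemma word_class_eq_iff:
  assumes "x \<in> lists X"
  shows "word_class X Q x = word_class X Q y \<longleftrightarrow> word_cong X Q x y"
proof
  assume "word_class X Q x = word_class X Q y"
  moreover have "x \<in> word_class X Q x"
    using word_cong.refl[OF assms] by (simp add: word_class_def)
  ultimately have "word_cong X Q y x" by (simp add: word_class_def)
  then show "word_cong X Q x y" by (rule word_cong.sym)
next
  assume "word_cong X Q x y"
  then have "word_cong X Q x z \<longleftrightarrow> word_cong X Q y z" for z
    by (metis word_cong.sym word_cong.trans)
  then show "word_class X Q x = word_class X Q y" by (simp add: word_class_def)
qed

lemma presented_mult:
  assumes "x \<in> lists X" "y \<in> lists X"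
  shows "word_class X Q x \<otimes>\<^bsub>presented X Q\<^esub> word_class X Q y = word_class X Q (x @ y)"
proof -
  have "(\<exists>x'. word_cong X Q x x' \<and> (\<exists>y'. word_cong X Q y y' \<and> word_cong X Q (x' @ y') z))
      \<longleftrightarrow> word_cong X Q (x @ y) z" for z
    using word_cong.refl[OF assms(1), of Q] word_cong.refl[OF assms(2), of Q]
    by (metis word_cong_append word_cong.trans)
  then show ?thesis
    by (simp add: presented_def word_class_def Bex_def)
qed

lemma group_presented:
  assumes inv: "\<And>g. g \<in> X \<Longrightarrow> \<exists>h\<in>X. [h, g] \<in> Q"
  shows "group (presented X Q)"
proof -
  have carrier: "carrier (presented X Q) = word_class X Q ` lists X"
    and one: "\<one>\<^bsub>presented X Q\<^esub> = word_class X Q []"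
    by (simp_all add: presented_def)
  have linv: "\<exists>y\<in>lists X. word_cong X Q (y @ x) []" if "x \<in> lists X" for x
    using that
  proof (induction x)
    case Nil
    show ?case by (rule bexI[of _ "[]"]) (simp_all add: word_cong.refl)
  next
    case (Cons g x)
    from Cons obtain y where y: "y \<in> lists X" "word_cong X Q (y @ x) []" by auto
    from inv Cons.hyps obtain h where h: "h \<in> X" "[h, g] \<in> Q" by blast
    have "word_cong X Q (y @ [h, g] @ x) (y @ x)"
      using word_cong.relator[of y X x "[h, g]" Q] y(1) h Cons.hyps by auto
    then have "word_cong X Q ((y @ [h]) @ g # x) []"
      using word_cong.trans[OF _ y(2)] by simp
    then show ?case using y(1) h(1) by (intro bexI[of _ "y @ [h]"]) auto
  qed
  show ?thesis
  proof (rule groupI)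
    fix C assume "C \<in> carrier (presented X Q)"
    then obtain x where x: "x \<in> lists X" "C = word_class X Q x" unfolding carrier by blast
    with linv obtain y where y: "y \<in> lists X" "word_cong X Q (y @ x) []" by blast
    have "y @ x \<in> lists X" using x y by simp
    then have "word_class X Q y \<otimes>\<^bsub>presented X Q\<^esub> C = \<one>\<^bsub>presented X Q\<^esub>"
      unfolding x(2) presented_mult[OF y(1) x(1)] one using y(2) by (simp only: word_class_eq_iff)
    with y(1) show "\<exists>D\<in>carrier (presented X Q). D \<otimes>\<^bsub>presented X Q\<^esub> C = \<one>\<^bsub>presented X Q\<^esub>"
      unfolding carrier by blast
  next
    fix C D assume "C \<in> carrier (presented X Q)" "D \<in> carrier (presented X Q)"
    then obtain x y where xy: "x \<in> lists X" "C = word_class X Q x"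
      "y \<in> lists X" "D = word_class X Q y" unfolding carrier by blast
    then have "x @ y \<in> lists X" by simp
    then show "C \<otimes>\<^bsub>presented X Q\<^esub> D \<in> carrier (presented X Q)"
      unfolding carrier xy presented_mult[OF xy(1,3)] by (rule imageI)
  next
    show "\<one>\<^bsub>presented X Q\<^esub> \<in> carrier (presented X Q)"
      unfolding carrier one by (rule imageI) simp
  next
    fix C D F assume "C \<in> carrier (presented X Q)" "D \<in> carrier (presented X Q)"
      "F \<in> carrier (presented X Q)"
    then obtain x y z where xyz: "x \<in> lists X" "C = word_class X Q x"
      "y \<in> lists X" "D = word_class X Q y" "z \<in> lists X" "F = word_class X Q z"
      unfolding carrier by blast
    then have "x @ y \<in> lists X" "y @ z \<in> lists X" by simp_all
    with xyz show "C \<otimes>\<^bsub>presented X Q\<^esub> D \<otimes>\<^bsub>presented X Q\<^esub> F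
        = C \<otimes>\<^bsub>presented X Q\<^esub> (D \<otimes>\<^bsub>presented X Q\<^esub> F)"
      by (simp only: presented_mult append_assoc)
  next
    fix C assume "C \<in> carrier (presented X Q)"
    then obtain x where x: "x \<in> lists X" "C = word_class X Q x" unfolding carrier by blast
    have "[] \<in> lists X" by simp
    with x show "\<one>\<^bsub>presented X Q\<^esub> \<otimes>\<^bsub>presented X Q\<^esub> C = C"
      by (simp only: one presented_mult append_Nil)
  qed
qed


section \<open>Cube groups\<close>

text \<open>
  An adjacency structure is given by sets \<open>E i\<close> with involutions \<open>\<iota> i\<close> and sets \<open>R i j\<close> of
  4-tuples, for \<open>i \<noteq> j\<close> in \<open>{1..k}\<close>. The \<open>E i\<close> may overlap inside the type \<open>'a\<close>; the disjoint
  union of the \<open>E i\<close> is the set of pairs \<open>(i, a)\<close> with \<open>a \<in> E i\<close>.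
\<close>

definition cube_group ::
  "nat \<Rightarrow> (nat \<Rightarrow> 'a set) \<Rightarrow> (nat \<Rightarrow> 'a \<Rightarrow> 'a) \<Rightarrow> (nat \<Rightarrow> nat \<Rightarrow> ('a \<times> 'a \<times> 'a \<times> 'a) set)
    \<Rightarrow> (nat \<times> 'a) list set monoid" where
  "cube_group k E \<iota> R = presented (Sigma {1..k} E)
     ({[(i, a), (i, \<iota> i a)] | i a. i \<in> {1..k} \<and> a \<in> E i} \<union>
      {[(i, a), (j, b), (i, a'), (j, b')] | i j a b a' b'.
         i \<in> {1..k} \<and> j \<in> {1..k} \<and> i \<noteq> j \<and> (a, b, a', b') \<in> R i j})"

definition edge_sets :: "nat \<Rightarrow> (nat \<Rightarrow> 'a set) \<Rightarrow> (nat \<Rightarrow> 'a \<Rightarrow> 'a) \<Rightarrow> bool" where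
  "edge_sets k E \<iota> \<longleftrightarrow> (\<forall>i\<in>{1..k}.
     finite (E i) \<and> (\<exists>m\<ge>2. card (E i) = 2 * m) \<and>
     (\<forall>a\<in>E i. \<iota> i a \<in> E i \<and> \<iota> i (\<iota> i a) = a \<and> \<iota> i a \<noteq> a))"

lemma group_cube_group:
  assumes "edge_sets k E \<iota>"
  shows "group (cube_group k E \<iota> R)"
  unfolding cube_group_def
proof (rule group_presented)
  fix g assume "g \<in> Sigma {1..k} E"
  then obtain i a where g: "g = (i, a)" and i: "i \<in> {1..k}" and a: "a \<in> E i" by auto
  from assms i a have "\<iota> i a \<in> E i" "\<iota> i (\<iota> i a) = a" unfolding edge_sets_def by auto
  with g i show "\<exists>h\<in>Sigma {1..k} E. [h, g] \<in>
      {[(i, a), (i, \<iota> i a)] | i a. i \<in> {1..k} \<and> a \<in> E i} \<union>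
      {[(i, a), (j, b), (i, a'), (j, b')] | i j a b a' b'.
         i \<in> {1..k} \<and> j \<in> {1..k} \<and> i \<noteq> j \<and> (a, b, a', b') \<in> R i j}"
    by (intro bexI[of _ "(i, \<iota> i a)"]) auto
qed

definition square_sets ::
  "nat \<Rightarrow> (nat \<Rightarrow> 'a set) \<Rightarrow> (nat \<Rightarrow> 'a \<Rightarrow> 'a) \<Rightarrow> (nat \<Rightarrow> nat \<Rightarrow> ('a \<times> 'a \<times> 'a \<times> 'a) set)
    \<Rightarrow> bool" where
  "square_sets k E \<iota> R \<longleftrightarrow> (\<forall>i\<in>{1..k}. \<forall>j\<in>{1..k}. i \<noteq> j \<longrightarrow>
     R i j \<subseteq> E i \<times> E j \<times> E i \<times> E j \<and>
     R j i = (\<lambda>(a, b, a', b'). (\<iota> j b', \<iota> i a', \<iota> j b, \<iota> i a)) ` R i j)"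

definition C1 ::
  "nat \<Rightarrow> (nat \<Rightarrow> 'a \<Rightarrow> 'a) \<Rightarrow> (nat \<Rightarrow> nat \<Rightarrow> ('a \<times> 'a \<times> 'a \<times> 'a) set) \<Rightarrow> bool" where
  "C1 k \<iota> R \<longleftrightarrow> (\<forall>i\<in>{1..k}. \<forall>j\<in>{1..k}. i \<noteq> j \<longrightarrow> (\<forall>a b a' b'. (a, b, a', b') \<in> R i j \<longrightarrow>
     (\<iota> i a, \<iota> j b', \<iota> i a', \<iota> j b) \<in> R i j \<and>
     (a', b', a, b) \<in> R i j \<and>
     (\<iota> i a', \<iota> j b, \<iota> i a, \<iota> j b') \<in> R i j \<and>
     distinct [(a, b, a', b'), (\<iota> i a, \<iota> j b', \<iota> i a', \<iota> j b),
               (a', b', a, b), (\<iota> i a', \<iota> j b, \<iota> i a, \<iota> j b')]))"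

definition C2 ::
  "nat \<Rightarrow> (nat \<Rightarrow> 'a set) \<Rightarrow> (nat \<Rightarrow> nat \<Rightarrow> ('a \<times> 'a \<times> 'a \<times> 'a) set) \<Rightarrow> bool" where
  "C2 k E R \<longleftrightarrow> (\<forall>i\<in>{1..k}. \<forall>j\<in>{1..k}. i \<noteq> j \<longrightarrow>
     bij_betw (\<lambda>(a, b, a', b'). (a, b)) (R i j) (E i \<times> E j) \<and>
     bij_betw (\<lambda>(a, b, a', b'). (a, b')) (R i j) (E i \<times> E j) \<and>
     bij_betw (\<lambda>(a, b, a', b'). (a', b')) (R i j) (E i \<times> E j) \<and>
     bij_betw (\<lambda>(a, b, a', b'). (b, a')) (R i j) (E j \<times> E i))"

text \<open>
  The system of elements \<open>u\<^sup>L\<close>, \<open>v\<^sub>i\<^sup>L\<close>, \<open>w\<^sub>i\<^sup>L\<close> is stored as \<open>edge_u c L\<close>, \<open>edge_v c L i\<close>,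
  \<open>edge_w c L i\<close>. The extensional function spaces below force the value \<open>undefined\<close> wherever the
  system has no entry, so that equality of records is equality of systems.
\<close>

record 'a cube =
  edge_u :: "nat set \<Rightarrow> 'a"
  edge_v :: "nat set \<Rightarrow> nat \<Rightarrow> 'a"
  edge_w :: "nat set \<Rightarrow> nat \<Rightarrow> 'a"

text \<open>
  Here \<open>n = card J + 1\<close>, so that \<open>card L < card J\<close> means \<open>card L \<le> n - 2\<close>.
\<close>

definition cube_system ::
  "(nat \<Rightarrow> 'a set) \<Rightarrow> (nat \<Rightarrow> 'a \<Rightarrow> 'a) \<Rightarrow> (nat \<Rightarrow> nat \<Rightarrow> ('a \<times> 'a \<times> 'a \<times> 'a) set)
    \<Rightarrow> nat \<Rightarrow> nat set \<Rightarrow> 'a cube \<Rightarrow> bool" where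
  "cube_system E \<iota> R p J c \<longleftrightarrow>
     edge_u c \<in> Pow J \<rightarrow>\<^sub>E E p \<and>
     edge_v c \<in> (\<Pi>\<^sub>E L\<in>Pow J. \<Pi>\<^sub>E i\<in>J - L. E i) \<and>
     edge_w c \<in> (\<Pi>\<^sub>E L\<in>Pow J. \<Pi>\<^sub>E i\<in>J - L. E i) \<and>
     (\<forall>L. L \<subseteq> J \<and> card L < card J \<longrightarrow>
        (\<forall>j\<in>J - L. (edge_u c L, edge_v c L j, edge_u c (L \<union> {j}), edge_w c L j) \<in> R p j) \<and>
        (\<forall>i\<in>J - L. \<forall>j\<in>J - L. i \<noteq> j \<longrightarrow>
           (\<iota> i (edge_v c L i), edge_v c L j,
            \<iota> i (edge_w c (L \<union> {j}) i), edge_w c (L \<union> {i}) j) \<in> R i j) \<and>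
        (\<forall>i\<in>J - L. \<forall>j\<in>J - L. i \<noteq> j \<longrightarrow>
           (edge_w c L i, \<iota> j (edge_w c L j),
            edge_v c (L \<union> {j}) i, \<iota> j (edge_v c (L \<union> {i}) j)) \<in> R i j))"

definition cube_extending ::
  "(nat \<Rightarrow> 'a set) \<Rightarrow> (nat \<Rightarrow> 'a \<Rightarrow> 'a) \<Rightarrow> (nat \<Rightarrow> nat \<Rightarrow> ('a \<times> 'a \<times> 'a \<times> 'a) set)
    \<Rightarrow> nat \<Rightarrow> nat set \<Rightarrow> 'a \<Rightarrow> (nat \<Rightarrow> 'a) \<Rightarrow> (nat \<Rightarrow> 'a) \<Rightarrow> (nat \<Rightarrow> 'a) \<Rightarrow> 'a cube \<Rightarrow> bool" where
  "cube_extending E \<iota> R p J u v u' w c \<longleftrightarrow>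
     cube_system E \<iota> R p J c \<and> edge_u c {} = u \<and>
     (\<forall>j\<in>J. edge_u c {j} = u' j \<and> edge_v c {} j = v j \<and> edge_w c {} j = w j)"

definition C3 ::
  "nat \<Rightarrow> (nat \<Rightarrow> 'a set) \<Rightarrow> (nat \<Rightarrow> 'a \<Rightarrow> 'a) \<Rightarrow> (nat \<Rightarrow> nat \<Rightarrow> ('a \<times> 'a \<times> 'a \<times> 'a) set)
    \<Rightarrow> bool" where
  "C3 k E \<iota> R \<longleftrightarrow> (\<forall>p\<in>{1..k}. \<forall>n\<in>{2..k}. \<forall>J. J \<subseteq> {1..k} - {p} \<and> card J = n - 1 \<longrightarrow>
     (\<forall>u v u' w. (\<forall>j\<in>J. (u, v j, u' j, w j) \<in> R p j) \<longrightarrow>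
        (\<exists>!c. cube_extending E \<iota> R p J u v u' w c)))"

text \<open>\<open>\<Gamma>\<close> is a \<open>k\<close>-cube group with adjacency structure \<open>E 1, \<dots>, E k\<close>.\<close>

definition is_cube_group ::
  "(nat \<times> 'a) list set monoid \<Rightarrow> nat \<Rightarrow> (nat \<Rightarrow> 'a set) \<Rightarrow> (nat \<Rightarrow> 'a \<Rightarrow> 'a)
    \<Rightarrow> (nat \<Rightarrow> nat \<Rightarrow> ('a \<times> 'a \<times> 'a \<times> 'a) set) \<Rightarrow> bool" where
  "is_cube_group \<Gamma> k E \<iota> R \<longleftrightarrow>
     k \<ge> 2 \<and> edge_sets k E \<iota> \<and> square_sets k E \<iota> R \<and> \<Gamma> = cube_group k E \<iota> R \<and>
     C1 k \<iota> R \<and> C2 k E R \<and> (k \<ge> 3 \<longrightarrow> C3 k E \<iota> R)"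


section \<open>Pointed cubes and adjacency matrices\<close>

text \<open>Pointed \<open>k\<close>-cubes, written with respect to the base direction \<open>p\<close>.\<close>

definition pointed_cubes ::
  "nat \<Rightarrow> (nat \<Rightarrow> 'a set) \<Rightarrow> (nat \<Rightarrow> 'a \<Rightarrow> 'a) \<Rightarrow> (nat \<Rightarrow> nat \<Rightarrow> ('a \<times> 'a \<times> 'a \<times> 'a) set)
    \<Rightarrow> nat \<Rightarrow> 'a cube set" where
  "pointed_cubes k E \<iota> R p =
     {c. \<exists>u v u' w. (\<forall>j\<in>{1..k} - {p}. (u, v j, u' j, w j) \<in> R p j) \<and>
           cube_extending E \<iota> R p ({1..k} - {p}) u v u' w c}"

lemma finite_pointed_cubes:
  assumes "edge_sets k E \<iota>" "p \<in> {1..k}"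
  shows "finite (pointed_cubes k E \<iota> R p)"
proof -
  let ?J = "{1..k} - {p}"
  let ?U = "Pow ?J \<rightarrow>\<^sub>E E p" and ?V = "\<Pi>\<^sub>E L\<in>Pow ?J. \<Pi>\<^sub>E i\<in>?J - L. E i"
  have fin: "finite (E i)" if "i \<in> {1..k}" for i
    using assms(1) that by (auto simp: edge_sets_def)
  have "finite ?J" by simp
  have "finite ?U"
    using fin[OF assms(2)] \<open>finite ?J\<close> by (simp only: finite_PiE finite_Pow_iff)
  moreover have "finite (\<Pi>\<^sub>E i\<in>?J - L. E i)" for L
    by (rule finite_PiE) (use fin in auto)
  then have "finite ?V"
    using \<open>finite ?J\<close> by (simp only: finite_PiE finite_Pow_iff)
  ultimately have "finite (?U \<times> ?V \<times> ?V)"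
    by (simp only: finite_cartesian_product)
  moreover have "(\<lambda>c. (edge_u c, edge_v c, edge_w c)) ` pointed_cubes k E \<iota> R p \<subseteq> ?U \<times> ?V \<times> ?V"
  proof
    fix x assume "x \<in> (\<lambda>c. (edge_u c, edge_v c, edge_w c)) ` pointed_cubes k E \<iota> R p"
    then obtain c where "x = (edge_u c, edge_v c, edge_w c)" "cube_system E \<iota> R p ?J c"
      unfolding pointed_cubes_def cube_extending_def by blast
    then show "x \<in> ?U \<times> ?V \<times> ?V"
      unfolding cube_system_def by (simp only: mem_Times_iff fst_conv snd_conv)
  qed
  moreover have "inj_on (\<lambda>c. (edge_u c, edge_v c, edge_w c)) (pointed_cubes k E \<iota> R p)"
    by (rule inj_onI) simp
  ultimately show ?thesis by (meson finite_imageD finite_subset)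
qed

text \<open>
  As a geometric cube, \<open>B\<close> is attached to the far face of \<open>A\<close> in direction \<open>p\<close>. The edge in
  direction \<open>j\<close> of that face at the position \<open>L\<close> is \<open>v\<^sub>j\<^sup>L\<close> if \<open>card L\<close> is even and \<open>w\<^sub>j\<^sup>L\<close> if it
  is odd, because \<open>u\<^sup>L\<close> changes its orientation with each step in \<open>L\<close>.
\<close>

definition adjacent_base :: "(nat \<Rightarrow> 'a \<Rightarrow> 'a) \<Rightarrow> nat \<Rightarrow> nat set \<Rightarrow> 'a cube \<Rightarrow> 'a cube \<Rightarrow> bool" where
  "adjacent_base \<iota> p J A B \<longleftrightarrow> (\<forall>L. L \<subseteq> J \<longrightarrow>
     edge_u A L \<noteq> \<iota> p (edge_u B L) \<and>
     (\<forall>j\<in>J - L. if even (card L) then edge_v A L j = \<iota> j (edge_w B L j)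
                else edge_w A L j = \<iota> j (edge_v B L j)))"

definition adjacent_other ::
  "(nat \<Rightarrow> 'a \<Rightarrow> 'a) \<Rightarrow> nat \<Rightarrow> nat set \<Rightarrow> nat \<Rightarrow> 'a cube \<Rightarrow> 'a cube \<Rightarrow> bool" where
  "adjacent_other \<iota> p J i A B \<longleftrightarrow> (\<forall>L. L \<subseteq> J - {i} \<longrightarrow>
     \<iota> p (edge_u B L) = edge_u A (L \<union> {i}) \<and>
     (\<forall>j\<in>J - (L \<union> {i}). \<iota> j (edge_v B L j) = edge_w A (L \<union> {i}) j \<and>
                         \<iota> j (edge_w B L j) = edge_v A (L \<union> {i}) j) \<and>
     edge_v A L i \<noteq> \<iota> i (edge_v B L i) \<and>
     edge_w A L i \<noteq> \<iota> i (edge_w B L i))"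

definition adjacency_matrix ::
  "nat \<Rightarrow> (nat \<Rightarrow> 'a \<Rightarrow> 'a) \<Rightarrow> nat \<Rightarrow> nat \<Rightarrow> 'a cube \<Rightarrow> 'a cube \<Rightarrow> int" where
  "adjacency_matrix k \<iota> p i A B =
     (if (if i = p then adjacent_base \<iota> p ({1..k} - {p}) A B
          else adjacent_other \<iota> p ({1..k} - {p}) i A B)
      then 1 else 0)"

text \<open>
  Matrices with rows and columns indexed by a finite set \<open>S\<close>; for the pointed cubes, finiteness is
  \<open>finite_pointed_cubes\<close>.
\<close>

definition matrix_product ::
  "'s set \<Rightarrow> ('s \<Rightarrow> 's \<Rightarrow> int) \<Rightarrow> ('s \<Rightarrow> 's \<Rightarrow> int) \<Rightarrow> 's \<Rightarrow> 's \<Rightarrow> int" where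
  "matrix_product S M N A B = (\<Sum>C\<in>S. M A C * N C B)"

definition matrices_commute :: "'s set \<Rightarrow> ('s \<Rightarrow> 's \<Rightarrow> int) \<Rightarrow> ('s \<Rightarrow> 's \<Rightarrow> int) \<Rightarrow> bool" where
  "matrices_commute S M N \<longleftrightarrow>
     (\<forall>A\<in>S. \<forall>B\<in>S. matrix_product S M N A B = matrix_product S N M A B)"

definition unique_common_extension :: "nat \<Rightarrow> 's set \<Rightarrow> (nat \<Rightarrow> 's \<Rightarrow> 's \<Rightarrow> int) \<Rightarrow> bool" where
  "unique_common_extension k S M \<longleftrightarrow>
     (k \<ge> 3 \<longrightarrow>
       (\<forall>p\<in>{1..k}. \<forall>q\<in>{1..k}. \<forall>r\<in>{1..k}. p \<noteq> q \<and> p \<noteq> r \<and> q \<noteq> r \<longrightarrow>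
         (\<forall>A\<in>S. \<forall>Bp\<in>S. \<forall>Bq\<in>S. \<forall>Br\<in>S.
           M p A Bp = 1 \<and> M q A Bq = 1 \<and> M r A Br = 1 \<longrightarrow>
           (\<exists>!(Cpq, Cpr, Cqr, D). Cpq \<in> S \<and> Cpr \<in> S \<and> Cqr \<in> S \<and> D \<in> S \<and>
              M p Bq Cpq = 1 \<and> M p Br Cpr = 1 \<and>
              M q Bp Cpq = 1 \<and> M q Br Cqr = 1 \<and>
              M r Bp Cpr = 1 \<and> M r Bq Cqr = 1 \<and>
              M p Cqr D = 1 \<and> M q Cpr D = 1 \<and> M r Cpq D = 1)))) \<and>
     (k = 2 \<longrightarrow>
       (\<forall>A\<in>S. \<forall>B\<in>S. \<forall>C\<in>S. M 1 A B = 1 \<and> M 2 A C = 1 \<longrightarrow>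
         (\<exists>!D. D \<in> S \<and> M 2 B D = 1 \<and> M 1 C D = 1)))"

end

theory Submission
  imports Defs
begin

text \<open>
  A pointed \<open>k\<close>-cube labels the edges of the geometric cube whose vertices are the subsets \<open>S\<close> of
  \<open>K = {1..k}\<close>: at each vertex and for each direction \<open>i\<close> there is a label in \<open>E i\<close> of the edge that
  leaves \<open>S\<close> in direction \<open>i\<close>. In these coordinates all directions, also \<open>p\<close>, and all vertices play
  the same role, and everything follows from one principle: a cube is determined by the \<open>k\<close> labels
  at any one vertex, and these can be prescribed arbitrarily. Uniqueness comes from C2: two labels
  at a vertex determine the square that they span, hence the labels at the next vertices, and so
  on; the same propagation works inside every face. Existence at one vertex is C3 (for \<open>k = 2\<close> it
  is C2), and propagation then moves it to every vertex.

  The matrix \<open>M\<^sub>i\<close> says that \<open>B\<close> continues \<open>A\<close> across the far face in direction \<open>i\<close> without folding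
  back. By propagation this holds as soon as it holds at a single vertex of the common face
  (\<open>adjacentI_at\<close>). Each existence claim therefore reduces to writing down the \<open>k\<close> labels at one
  vertex and comparing labels at one vertex, and each uniqueness claim to observing that the
  prescribed neighbours fix all labels at one vertex.

  For commutation, \<open>exchange_ex1\<close> replaces a path \<open>A, B, D\<close> through the directions \<open>p, q\<close> by a unique
  path through the directions \<open>q, p\<close>. Applied twice, it shows that an entry of either product counts
  at most one path, and that both products have the same support. For common extensions, the
  three cubes \<open>C\<close> and the cube \<open>D\<close> arise by completing squares (\<open>common_extension_exists\<close>), and \<open>D\<close> is
  adjacent to the third \<open>C\<close> by \<open>third_face_adjacent\<close>.
\<close>

section \<open>Cubes determined by the edges at a vertex\<close>

text \<open>
  The label of the edge leaving the vertex \<open>S\<close> of the cube \<open>A\<close> in direction \<open>i\<close> is \<open>e A S i\<close>. The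
  assumption \<open>step\<close> is the propagation along one edge, which may compare different vertices of
  different cubes; for \<open>i = j\<close> it says that a label determines that of the reversed edge. It is
  enough to prescribe labels at one fixed vertex \<open>V\<close>, see \<open>fill\<close>.
\<close>

locale corner_determined_cubes =
  fixes K :: "nat set" and E :: "nat \<Rightarrow> 'a set" and X :: "'c set"
    and e :: "'c \<Rightarrow> nat set \<Rightarrow> nat \<Rightarrow> 'a" and V :: "nat set"
  assumes finite_directions: "finite K"
    and label_in: "A \<in> X \<Longrightarrow> S \<subseteq> K \<Longrightarrow> i \<in> K \<Longrightarrow> e A S i \<in> E i"
    and step: "A \<in> X \<Longrightarrow> B \<in> X \<Longrightarrow> S \<subseteq> K \<Longrightarrow> T \<subseteq> K \<Longrightarrow> i \<in> K \<Longrightarrow> j \<in> K \<Longrightarrow>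
      e A S i = e B T i \<Longrightarrow> e A S j = e B T j \<Longrightarrow> e A (sym_diff S {i}) j = e B (sym_diff T {i}) j"
    and corner: "V \<subseteq> K"
    and fill_corner: "(\<And>i. i \<in> K \<Longrightarrow> a i \<in> E i) \<Longrightarrow> \<exists>A\<in>X. \<forall>i\<in>K. e A V i = a i"
    and ext: "A \<in> X \<Longrightarrow> B \<in> X \<Longrightarrow> (\<And>S i. S \<subseteq> K \<Longrightarrow> i \<in> K \<Longrightarrow> e A S i = e B S i) \<Longrightarrow> A = B"
begin

text \<open>
  Repeated steps along the directions in \<open>U\<close>. Taking \<open>D = K\<close> gives whole cubes, and taking for \<open>D\<close>
  all directions but one gives the faces across which cubes are adjacent.
\<close>

lemma agree_on_face:
  assumes AB: "A \<in> X" "B \<in> X" and ST: "S \<subseteq> K" "T \<subseteq> K" and D: "D \<subseteq> K"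
    and agree: "\<And>j. j \<in> D \<Longrightarrow> e A S j = e B T j"
    and U: "U \<subseteq> D" and j: "j \<in> D"
  shows "e A (sym_diff S U) j = e B (sym_diff T U) j"
proof -
  have "finite U"
    using U D finite_directions by (meson finite_subset)
  then show ?thesis
    using U j
  proof (induction U arbitrary: j)
    case empty
    then show ?case using agree by simp
  next
    case (insert i U)
    have eq: "sym_diff W (insert i U) = sym_diff (sym_diff W U) {i}" for W
      using insert.hyps by auto
    have "sym_diff S U \<subseteq> K" "sym_diff T U \<subseteq> K" "i \<in> K" "j \<in> K"
      using insert.prems ST D by auto
    with insert show ?case
      unfolding eq by (intro step[OF AB]) auto
  qed
qed

text \<open>
  Moving the base vertex: \<open>B\<close> is the cube with the labels of \<open>A\<close> at the vertex \<open>V + T\<close> (sum modulo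
  two) as its labels at \<open>V\<close>. As \<open>agree_on_face\<close> compares labels at different vertices, \<open>B\<close> is then the
  translate of \<open>A\<close> by \<open>T\<close> everywhere.
\<close>

lemma reflect:
  assumes A: "A \<in> X" and T: "T \<subseteq> K"
  obtains B where "B \<in> X" "\<And>S j. S \<subseteq> K \<Longrightarrow> j \<in> K \<Longrightarrow> e B S j = e A (sym_diff S T) j"
proof -
  have VT: "sym_diff V T \<subseteq> K" using corner T by auto
  obtain B where B: "B \<in> X" "\<forall>i\<in>K. e B V i = e A (sym_diff V T) i"
    using fill_corner[of "e A (sym_diff V T)"] label_in[OF A VT] by auto
  have "e B S j = e A (sym_diff S T) j" if "S \<subseteq> K" "j \<in> K" for S j
  proof -
    have "e B (sym_diff V (sym_diff S V)) j = e A (sym_diff (sym_diff V T) (sym_diff S V)) j"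
      by (rule agree_on_face[OF B(1) A corner VT, of K]) (use B that corner in auto)
    moreover have "sym_diff V (sym_diff S V) = S"
      "sym_diff (sym_diff V T) (sym_diff S V) = sym_diff S T" by auto
    ultimately show ?thesis by simp
  qed
  with B(1) show ?thesis by (rule that)
qed

lemma fill:
  assumes T: "T \<subseteq> K" and a: "\<And>i. i \<in> K \<Longrightarrow> a i \<in> E i"
  obtains A where "A \<in> X" "\<And>i. i \<in> K \<Longrightarrow> e A T i = a i"
proof -
  obtain B where B: "B \<in> X" "\<forall>i\<in>K. e B V i = a i"
    using fill_corner[of a] a by blast
  have "sym_diff T V \<subseteq> K" using T corner by auto
  from reflect[OF B(1) this] obtain A where A: "A \<in> X"
    "\<And>S j. S \<subseteq> K \<Longrightarrow> j \<in> K \<Longrightarrow> e A S j = e B (sym_diff S (sym_diff T V)) j" by metis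
  have "sym_diff T (sym_diff T V) = V" by auto
  with A B T show ?thesis by (intro that[of A]) simp_all
qed

lemma eq_if_agree_at:
  assumes AB: "A \<in> X" "B \<in> X" and T: "T \<subseteq> K" and agree: "\<And>i. i \<in> K \<Longrightarrow> e A T i = e B T i"
  shows "A = B"
proof (rule ext[OF AB])
  fix S i assume "S \<subseteq> K" "i \<in> K"
  then have "e A (sym_diff T (sym_diff S T)) i = e B (sym_diff T (sym_diff S T)) i"
    by (intro agree_on_face[OF AB T T, of K] agree) (use T in auto)
  moreover have "sym_diff T (sym_diff S T) = S" by auto
  ultimately show "e A S i = e B S i" by simp
qed

text \<open>
  The far face of \<open>A\<close> in direction \<open>i\<close> is the near face of \<open>B\<close>. If the labels in the inequality
  agreed, \<open>B\<close> would be the mirror image of \<open>A\<close> in this face.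
\<close>

definition adjacent :: "nat \<Rightarrow> 'c \<Rightarrow> 'c \<Rightarrow> bool" where
  "adjacent i A B \<longleftrightarrow> (\<forall>S. S \<subseteq> K - {i} \<longrightarrow>
     (\<forall>j\<in>K - {i}. e A (insert i S) j = e B S j) \<and> e A (insert i S) i \<noteq> e B S i)"

lemma adjacentD:
  assumes "adjacent i A B" "S \<subseteq> K" "i \<notin> S"
  shows "j \<in> K \<Longrightarrow> j \<noteq> i \<Longrightarrow> e A (insert i S) j = e B S j" "e A (insert i S) i \<noteq> e B S i"
  using assms unfolding adjacent_def by blast+

text \<open>
  The labels in the face propagate from \<open>T\<close> by \<open>agree_on_face\<close>. If \<open>B\<close> folded back onto \<open>A\<close> at some
  other vertex of the face, all labels of \<open>A\<close> and \<open>B\<close> there would agree, and propagating them back to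
  \<open>T\<close> would contradict the inequality at \<open>T\<close>.
\<close>

lemma adjacentI_at:
  assumes AB: "A \<in> X" "B \<in> X" and i: "i \<in> K" and T: "T \<subseteq> K" "i \<notin> T"
    and face: "\<And>j. j \<in> K \<Longrightarrow> j \<noteq> i \<Longrightarrow> e A (insert i T) j = e B T j"
    and edge: "e A (insert i T) i \<noteq> e B T i"
  shows "adjacent i A B"
proof -
  have face': "e A (insert i S) j = e B S j" if "S \<subseteq> K - {i}" "j \<in> K - {i}" for S j
  proof -
    have "e A (sym_diff (insert i T) (sym_diff S T)) j = e B (sym_diff T (sym_diff S T)) j"
      by (rule agree_on_face[OF AB, of _ _ "K - {i}"]) (use i T face that in auto)
    moreover have "sym_diff (insert i T) (sym_diff S T) = insert i S"
      "sym_diff T (sym_diff S T) = S" using that T by auto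
    ultimately show ?thesis by simp
  qed
  have "e A (insert i S) i \<noteq> e B S i" if S: "S \<subseteq> K - {i}" for S
  proof
    assume eq: "e A (insert i S) i = e B S i"
    have "e A (sym_diff (insert i S) (sym_diff S T)) i = e B (sym_diff S (sym_diff S T)) i"
    proof (rule agree_on_face[OF AB, of _ _ K])
      fix j assume "j \<in> K"
      with face'[OF S, of j] eq show "e A (insert i S) j = e B S j" by (cases "j = i") auto
    qed (use i S T in auto)
    moreover have "sym_diff (insert i S) (sym_diff S T) = insert i T"
      "sym_diff S (sym_diff S T) = T" using S T by auto
    ultimately show False using edge by simp
  qed
  with face' show ?thesis unfolding adjacent_def by blast
qed

text \<open>
  The labels of \<open>D\<close> at the vertex \<open>{}\<close> can all be read off from \<open>B\<close> and \<open>C\<close>: those in the directions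
  other than \<open>q\<close> from \<open>B\<close>, the one in direction \<open>q\<close> from \<open>C\<close>.
\<close>

lemma common_extension_unique:
  assumes "D \<in> X" "D' \<in> X" and pq: "p \<in> K" "q \<in> K" "p \<noteq> q"
    and "adjacent q B D" "adjacent p C D" "adjacent q B D'" "adjacent p C D'"
  shows "D = D'"
proof (rule eq_if_agree_at[of _ _ "{}"])
  fix j assume "j \<in> K"
  then show "e D {} j = e D' {} j"
    using adjacentD(1)[OF assms(6), of "{}" j] adjacentD(1)[OF assms(8), of "{}" j]
      adjacentD(1)[OF assms(7), of "{}" j] adjacentD(1)[OF assms(9), of "{}" j] pq
    by (cases "j = q") auto
qed (use assms in auto)

lemma common_extension_exists:
  assumes X: "A \<in> X" "B \<in> X" "C \<in> X" and pq: "p \<in> K" "q \<in> K" "p \<noteq> q"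
    and AB: "adjacent p A B" and AC: "adjacent q A C"
  obtains D where "D \<in> X" "adjacent q B D" "adjacent p C D"
proof -
  let ?a = "\<lambda>j. if j = q then e C {p} q else e B {q} j"
  obtain D where D: "D \<in> X" "\<And>j. j \<in> K \<Longrightarrow> e D {} j = ?a j"
    by (rule fill[of "{}" ?a]) (use X pq in \<open>auto intro: label_in\<close>)
  have B: "j \<in> K \<Longrightarrow> j \<noteq> p \<Longrightarrow> e A {p, q} j = e B {q} j" "e A {p, q} p \<noteq> e B {q} p" for j
    using adjacentD[OF AB, of "{q}"] pq by auto
  have C: "j \<in> K \<Longrightarrow> j \<noteq> q \<Longrightarrow> e A {p, q} j = e C {p} j" "e A {p, q} q \<noteq> e C {p} q" for j
    using adjacentD[OF AC, of "{p}"] pq by (auto simp: insert_commute)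
  have "adjacent q B D"
    by (rule adjacentI_at[of _ _ _ "{}"]) (use X D pq B(1)[of q] C(2) in auto)
  moreover have "adjacent p C D"
  proof (rule adjacentI_at[of _ _ _ "{}"])
    show "e C (insert p {}) j = e D {} j" if "j \<in> K" "j \<noteq> p" for j
      using that D(2) B(1)[of j] C(1)[of j] by (cases "j = q") auto
    show "e C (insert p {}) p \<noteq> e D {} p"
      using D(2)[of p] B(2) C(1)[of p] pq by simp
  qed (use X D pq in auto)
  ultimately show ?thesis using that D(1) by blast
qed

text \<open>
  The vertex \<open>{p}\<close> of \<open>C\<close> lies in both common faces: all labels of \<open>C\<close> there except that in direction
  \<open>q\<close> come from \<open>A\<close>, and that one comes from \<open>D\<close>.
\<close>

lemma exchange_ex1:
  assumes X: "A \<in> X" "B \<in> X" "D \<in> X" and pq: "p \<in> K" "q \<in> K" "p \<noteq> q"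
    and AB: "adjacent p A B" and BD: "adjacent q B D"
  shows "\<exists>!C. C \<in> X \<and> adjacent q A C \<and> adjacent p C D"
proof -
  let ?a = "\<lambda>j. if j = q then e D {} q else e A {p, q} j"
  obtain C where C: "C \<in> X" "\<And>j. j \<in> K \<Longrightarrow> e C {p} j = ?a j"
    by (rule fill[of "{p}" ?a]) (use X pq in \<open>auto intro: label_in\<close>)
  have B: "j \<in> K \<Longrightarrow> j \<noteq> p \<Longrightarrow> e A {p, q} j = e B {q} j" "e A {p, q} p \<noteq> e B {q} p" for j
    using adjacentD[OF AB, of "{q}"] pq by auto
  have D: "j \<in> K \<Longrightarrow> j \<noteq> q \<Longrightarrow> e B {q} j = e D {} j" "e B {q} q \<noteq> e D {} q" for j
    using adjacentD[OF BD, of "{}"] pq by auto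
  have "adjacent q A C"
    by (rule adjacentI_at[of _ _ _ "{p}"])
      (use X C pq B(1)[of q] D(2) in \<open>auto simp: insert_commute\<close>)
  moreover have "adjacent p C D"
  proof (rule adjacentI_at[of _ _ _ "{}"])
    show "e C (insert p {}) j = e D {} j" if "j \<in> K" "j \<noteq> p" for j
      using that C(2) B(1)[of j] D(1)[of j] by (cases "j = q") auto
    show "e C (insert p {}) p \<noteq> e D {} p"
      using C(2)[of p] B(2) D(1)[of p] pq by simp
  qed (use X C pq in auto)
  moreover have "C' = C" if C': "C' \<in> X" "adjacent q A C'" "adjacent p C' D" for C'
  proof (rule eq_if_agree_at[of _ _ "{p}"])
    fix j assume "j \<in> K"
    then show "e C' {p} j = e C {p} j"
      using adjacentD(1)[OF C'(2), of "{p}" j] adjacentD(1)[OF C'(3), of "{}" j] C(2)[of j] pq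
      by (cases "j = q") (auto simp: insert_commute)
  qed (use C' C pq in auto)
  ultimately show ?thesis using C(1) by blast
qed

text \<open>
  At the vertex \<open>{}\<close>, the label of \<open>D\<close> in direction \<open>p\<close> and that of \<open>Cpq\<close> across the face in direction
  \<open>r\<close> are both labels of \<open>Bp\<close> at \<open>{q, r}\<close>; in any other direction within the face both are labels of
  \<open>Bq\<close> at \<open>{p, r}\<close>. No folding occurs because \<open>Cpr\<close> does not fold back onto \<open>Bp\<close>.
\<close>

lemma third_face_adjacent:
  assumes X: "Bp \<in> X" "Bq \<in> X" "Cpq \<in> X" "Cpr \<in> X" "Cqr \<in> X" "D \<in> X"
    and pqr: "p \<in> K" "q \<in> K" "r \<in> K" "p \<noteq> q" "p \<noteq> r" "q \<noteq> r"
    and adj: "adjacent p Bq Cpq" "adjacent q Bp Cpq" "adjacent r Bp Cpr" "adjacent r Bq Cqr"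
      "adjacent p Cqr D" "adjacent q Cpr D"
  shows "adjacent r Cpq D"
proof (rule adjacentI_at[of _ _ _ "{}"])
  show "e Cpq (insert r {}) j = e D {} j" if j: "j \<in> K" "j \<noteq> r" for j
  proof (cases "j = p")
    case True
    then show ?thesis
      using adjacentD(1)[OF adj(2), of "{r}" p] adjacentD(1)[OF adj(3), of "{q}" p]
        adjacentD(1)[OF adj(6), of "{}" p] pqr by (simp add: insert_commute)
  next
    case False
    then show ?thesis
      using adjacentD(1)[OF adj(1), of "{r}" j] adjacentD(1)[OF adj(4), of "{p}" j]
        adjacentD(1)[OF adj(5), of "{}" j] pqr j by (simp add: insert_commute)
  qed
  show "e Cpq (insert r {}) r \<noteq> e D {} r"
    using adjacentD(1)[OF adj(2), of "{r}" r] adjacentD(2)[OF adj(3), of "{q}"]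
      adjacentD(1)[OF adj(6), of "{}" r] pqr by (simp add: insert_commute)
qed (use X pqr in auto)

text \<open>
  An entry of the product counts the paths from \<open>A\<close> to \<open>D\<close> through the directions \<open>p, q\<close>. Exchanging
  such a path twice shows that it is the only one.
\<close>

lemma matrix_product_adjacent:
  assumes "finite X"
    and M: "\<And>A B. A \<in> X \<Longrightarrow> B \<in> X \<Longrightarrow> M A B = (if adjacent p A B then 1 else 0)"
    and N: "\<And>A B. A \<in> X \<Longrightarrow> B \<in> X \<Longrightarrow> N A B = (if adjacent q A B then 1 else 0)"
    and pq: "p \<in> K" "q \<in> K" "p \<noteq> q" and AD: "A \<in> X" "D \<in> X"
  shows "matrix_product X M N A D =
    (if \<exists>B\<in>X. adjacent p A B \<and> adjacent q B D then 1 else 0)"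
proof -
  have "matrix_product X M N A D = (\<Sum>B\<in>X. if adjacent p A B \<and> adjacent q B D then 1 else 0)"
    unfolding matrix_product_def by (rule sum.cong) (simp_all add: M N AD)
  also have "\<dots> = int (card {B \<in> X. adjacent p A B \<and> adjacent q B D})"
    using assms(1) by (simp add: sum.If_cases Int_def)
  also have "\<dots> = (if \<exists>B\<in>X. adjacent p A B \<and> adjacent q B D then 1 else 0)"
  proof (cases "\<exists>B\<in>X. adjacent p A B \<and> adjacent q B D")
    case True
    then obtain B where B: "B \<in> X" "adjacent p A B" "adjacent q B D" by blast
    then obtain C where C: "C \<in> X" "adjacent q A C" "adjacent p C D"
      using exchange_ex1[OF AD(1) _ AD(2) pq] by blast
    have "\<exists>!B. B \<in> X \<and> adjacent p A B \<and> adjacent q B D"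
      by (rule exchange_ex1[OF AD(1) C(1) AD(2) pq(2,1)]) (use pq C in auto)
    then have "{B \<in> X. adjacent p A B \<and> adjacent q B D} = {B}" using B by blast
    then show ?thesis using True by simp
  next
    case False
    then have "{B \<in> X. adjacent p A B \<and> adjacent q B D} = {}" by blast
    then show ?thesis by (simp only: False if_False card.empty of_nat_0)
  qed
  finally show ?thesis .
qed

lemma adjacency_matrices_commute:
  assumes fin: "finite X"
    and M: "\<And>i A B. i \<in> K \<Longrightarrow> A \<in> X \<Longrightarrow> B \<in> X \<Longrightarrow> M i A B = (if adjacent i A B then 1 else 0)"
    and pq: "p \<in> K" "q \<in> K"
  shows "matrices_commute X (M p) (M q)"
proof (cases "p = q")
  case True
  then show ?thesis by (simp add: matrices_commute_def)
next
  case False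
  have "(\<exists>B\<in>X. adjacent p A B \<and> adjacent q B D) \<longleftrightarrow> (\<exists>C\<in>X. adjacent q A C \<and> adjacent p C D)"
    if "A \<in> X" "D \<in> X" for A D
    using exchange_ex1[of A _ D p q] exchange_ex1[of A _ D q p] that pq False by blast
  then show ?thesis
    using matrix_product_adjacent[OF fin M M, of p q] matrix_product_adjacent[OF fin M M, of q p]
      pq False by (simp add: matrices_commute_def)
qed

lemma common_extension_ex1:
  assumes "A \<in> X" "B \<in> X" "C \<in> X" "p \<in> K" "q \<in> K" "p \<noteq> q" "adjacent p A B" "adjacent q A C"
  shows "\<exists>!D. D \<in> X \<and> adjacent q B D \<and> adjacent p C D"
proof -
  obtain D where "D \<in> X" "adjacent q B D" "adjacent p C D"
    using common_extension_exists[OF assms] .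
  then show ?thesis
    using common_extension_unique[OF _ _ assms(4-6), of _ _ B C] by blast
qed

lemma unique_common_extension_triple:
  assumes X: "A \<in> X" "Bp \<in> X" "Bq \<in> X" "Br \<in> X"
    and pqr: "p \<in> K" "q \<in> K" "r \<in> K" "p \<noteq> q" "p \<noteq> r" "q \<noteq> r"
    and adj: "adjacent p A Bp" "adjacent q A Bq" "adjacent r A Br"
  shows "\<exists>!(Cpq, Cpr, Cqr, D). Cpq \<in> X \<and> Cpr \<in> X \<and> Cqr \<in> X \<and> D \<in> X \<and>
    adjacent p Bq Cpq \<and> adjacent p Br Cpr \<and> adjacent q Bp Cpq \<and> adjacent q Br Cqr \<and>
    adjacent r Bp Cpr \<and> adjacent r Bq Cqr \<and>
    adjacent p Cqr D \<and> adjacent q Cpr D \<and> adjacent r Cpq D" (is "\<exists>!Z. ?P Z")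
proof -
  obtain Cpq where Cpq: "Cpq \<in> X" "adjacent q Bp Cpq" "adjacent p Bq Cpq"
    using common_extension_exists[OF X(1,2,3) pqr(1,2,4) adj(1,2)] .
  obtain Cpr where Cpr: "Cpr \<in> X" "adjacent r Bp Cpr" "adjacent p Br Cpr"
    using common_extension_exists[OF X(1,2,4) pqr(1,3,5) adj(1,3)] .
  obtain Cqr where Cqr: "Cqr \<in> X" "adjacent r Bq Cqr" "adjacent q Br Cqr"
    using common_extension_exists[OF X(1,3,4) pqr(2,3,6) adj(2,3)] .
  obtain D where D: "D \<in> X" "adjacent q Cpr D" "adjacent p Cqr D"
    using common_extension_exists[OF X(4) Cpr(1) Cqr(1) pqr(1,2,4) Cpr(3) Cqr(3)] .
  have "adjacent r Cpq D"
    by (rule third_face_adjacent[OF X(2,3) Cpq(1) Cpr(1) Cqr(1) D(1) pqr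
          Cpq(3,2) Cpr(2) Cqr(2) D(3,2)])
  show ?thesis
  proof (rule ex1I[of ?P "(Cpq, Cpr, Cqr, D)"])
    show "?P (Cpq, Cpr, Cqr, D)" using Cpq Cpr Cqr D \<open>adjacent r Cpq D\<close> by simp
  next
    fix Z assume "?P Z"
    moreover obtain Cpq' Cpr' Cqr' D' where Z: "Z = (Cpq', Cpr', Cqr', D')" by (cases Z)
    ultimately have Z': "Cpq' \<in> X" "adjacent q Bp Cpq'" "adjacent p Bq Cpq'"
      "Cpr' \<in> X" "adjacent r Bp Cpr'" "adjacent p Br Cpr'"
      "Cqr' \<in> X" "adjacent r Bq Cqr'" "adjacent q Br Cqr'"
      "D' \<in> X" "adjacent q Cpr' D'" "adjacent p Cqr' D'" by simp_all
    have "Cpq' = Cpq"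
      by (rule common_extension_unique[OF Z'(1) Cpq(1) pqr(1,2,4) Z'(2,3) Cpq(2,3)])
    moreover have Cpr': "Cpr' = Cpr"
      by (rule common_extension_unique[OF Z'(4) Cpr(1) pqr(1,3,5) Z'(5,6) Cpr(2,3)])
    moreover have Cqr': "Cqr' = Cqr"
      by (rule common_extension_unique[OF Z'(7) Cqr(1) pqr(2,3,6) Z'(8,9) Cqr(2,3)])
    moreover have "D' = D"
      by (rule common_extension_unique[OF Z'(10) D(1) pqr(1,2,4)
            Z'(11)[unfolded Cpr'] Z'(12)[unfolded Cqr'] D(2,3)])
    ultimately show "Z = (Cpq, Cpr, Cqr, D)" unfolding Z by simp
  qed
qed

end

section \<open>The edge labels of a pointed cube\<close>

text \<open>
  The combinatorial data of a \<open>k\<close>-cube group, together with the direction \<open>p\<close> that is used to write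
  down the cubes.
\<close>

locale cube_complex =
  fixes k :: nat and E :: "nat \<Rightarrow> 'a set" and \<iota> :: "nat \<Rightarrow> 'a \<Rightarrow> 'a"
    and R :: "nat \<Rightarrow> nat \<Rightarrow> ('a \<times> 'a \<times> 'a \<times> 'a) set" and p :: nat
  assumes dim: "k \<ge> 2" and edges: "edge_sets k E \<iota>" and squares: "square_sets k E \<iota> R"
    and C1: "C1 k \<iota> R" and C2: "C2 k E R" and C3: "k \<ge> 3 \<Longrightarrow> C3 k E \<iota> R"
    and base: "p \<in> {1..k}"
begin

abbreviation "K \<equiv> {1..k}"
abbreviation "J \<equiv> {1..k} - {p}"
abbreviation "cubes \<equiv> pointed_cubes k E \<iota> R p"

text \<open>
  The vertex of the geometric cube at \<open>L\<close> and height \<open>0\<close> or \<open>1\<close> in direction \<open>p\<close> is \<open>L\<close> or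
  \<open>insert p L\<close>. The label \<open>u\<^sup>L\<close> runs upwards if \<open>card L\<close> is even and downwards otherwise, so it starts at
  that one of the two vertices which has even cardinality. The label \<open>v\<^sub>i\<^sup>L\<close> starts at its end, the
  vertex of odd cardinality, and goes away from \<open>L\<close>, while \<open>w\<^sub>i\<^sup>L\<close> comes back to its start, the vertex
  of even cardinality. The remaining labels are inverses of these. Hence only the parity of \<open>card S\<close>
  decides which entry is read at \<open>S\<close>.
\<close>

definition label :: "'a cube \<Rightarrow> nat set \<Rightarrow> nat \<Rightarrow> 'a" where
  "label c S i =
    (if i = p then (if even (card S) then edge_u c (S - {p}) else \<iota> p (edge_u c (S - {p})))
     else if i \<in> S then
       (if even (card S) then \<iota> i (edge_v c (S - {p, i}) i) else edge_w c (S - {p, i}) i)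
     else (if even (card S) then \<iota> i (edge_w c (S - {p}) i) else edge_v c (S - {p}) i))"

lemma inv_in: "i \<in> K \<Longrightarrow> a \<in> E i \<Longrightarrow> \<iota> i a \<in> E i"
  and inv_inv: "i \<in> K \<Longrightarrow> a \<in> E i \<Longrightarrow> \<iota> i (\<iota> i a) = a"
  using edges unfolding edge_sets_def by auto

lemma inv_eq_iff: "i \<in> K \<Longrightarrow> a \<in> E i \<Longrightarrow> b \<in> E i \<Longrightarrow> \<iota> i a = b \<longleftrightarrow> a = \<iota> i b"
  using inv_inv by auto

lemma card_insert_even: "S \<subseteq> K \<Longrightarrow> i \<notin> S \<Longrightarrow> even (card (insert i S)) \<longleftrightarrow> odd (card S)"
  by (simp add: finite_subset[OF _ finite_atLeastAtMost])

lemma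
  assumes "c \<in> cubes"
  shows edge_u_in: "L \<subseteq> J \<Longrightarrow> edge_u c L \<in> E p"
    and edge_v_in: "L \<subseteq> J \<Longrightarrow> i \<in> J - L \<Longrightarrow> edge_v c L i \<in> E i"
    and edge_w_in: "L \<subseteq> J \<Longrightarrow> i \<in> J - L \<Longrightarrow> edge_w c L i \<in> E i"
  using assms unfolding pointed_cubes_def cube_extending_def cube_system_def
  by (auto simp: PiE_def Pi_def)

lemma label_in:
  assumes "c \<in> cubes" "S \<subseteq> K" "i \<in> K"
  shows "label c S i \<in> E i"
proof -
  have "S - {p} \<subseteq> J" "S - {p, i} \<subseteq> J" using assms by auto
  then show ?thesis
    using edge_u_in[OF assms(1)] edge_v_in[OF assms(1)] edge_w_in[OF assms(1)] assms base inv_in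
    unfolding label_def by auto
qed

lemma label_insert:
  assumes c: "c \<in> cubes" and S: "S \<subseteq> K" and i: "i \<in> K" "i \<notin> S"
  shows "label c (insert i S) i = \<iota> i (label c S i)"
proof (cases "i = p")
  case True
  have "S - {p} = S" "S \<subseteq> J" using True i S by auto
  then show ?thesis
    using True card_insert_even[OF S i(2)] inv_inv[OF base edge_u_in[OF c, of S]] i
    by (auto simp: label_def)
next
  case False
  have "S - {p} \<subseteq> J" "insert i S - {p, i} = S - {p}" "i \<in> J - (S - {p})" using False i S by auto
  then show ?thesis
    using False card_insert_even[OF S i(2)] inv_inv[OF i(1) edge_w_in[OF c, of "S - {p}" i]] i
    by (auto simp: label_def)
qed

lemma label_flip:
  assumes c: "c \<in> cubes" and S: "S \<subseteq> K" and i: "i \<in> K"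
  shows "label c (sym_diff S {i}) i = \<iota> i (label c S i)"
proof (cases "i \<in> S")
  case True
  then have "sym_diff S {i} = S - {i}" by auto
  moreover have "label c S i = \<iota> i (label c (S - {i}) i)"
    using label_insert[OF c _ i, of "S - {i}"] S True by (simp add: insert_absorb subset_iff)
  moreover have "S - {i} \<subseteq> K" using S by auto
  ultimately show ?thesis using inv_inv[OF i label_in[OF c _ i]] by simp
next
  case False
  then have "sym_diff S {i} = insert i S" by auto
  then show ?thesis using label_insert[OF c S i False] by simp
qed

text \<open>
  The square at \<open>S\<close>, with the sides in the directions \<open>i, j, i, j\<close> met on a walk around it from \<open>S\<close>.
\<close>

definition square_at :: "'a cube \<Rightarrow> nat set \<Rightarrow> nat \<Rightarrow> nat \<Rightarrow> bool" where
  "square_at c S i j \<longleftrightarrow>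
    (label c S i, label c (sym_diff S {i}) j,
     label c (sym_diff S {i, j}) i, label c (sym_diff S {j}) j) \<in> R i j"

text \<open>
  C1 and the identification of \<open>R i j\<close> with \<open>R j i\<close> say that \<open>R\<close> does not depend on the corner at which
  the walk around a square starts, nor on the sense of the walk. This reduces all squares of a cube
  to those listed in \<open>cube_system\<close>.
\<close>

lemma square_at_flip:
  assumes c: "c \<in> cubes" and S: "S \<subseteq> K" and ij: "i \<in> K" "j \<in> K" "i \<noteq> j"
    and sq: "square_at c S i j"
  shows "square_at c (sym_diff S {i}) i j" "square_at c (sym_diff S {j}) i j" "square_at c S j i"
proof -
  have sub: "sym_diff S {i} \<subseteq> K" "sym_diff S {j} \<subseteq> K" "sym_diff S {i, j} \<subseteq> K"
    using S ij by auto
  have eqs: "sym_diff (sym_diff S {i}) {i} = S" "sym_diff (sym_diff S {j}) {j} = S"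
    "sym_diff (sym_diff S {i}) {j} = sym_diff S {i, j}"
    "sym_diff (sym_diff S {j}) {i} = sym_diff S {i, j}"
    "sym_diff (sym_diff S {i}) {i, j} = sym_diff S {j}"
    "sym_diff (sym_diff S {j}) {i, j} = sym_diff S {i}"
    "sym_diff (sym_diff S {i, j}) {i} = sym_diff S {j}"
    "sym_diff (sym_diff S {i, j}) {j} = sym_diff S {i}"
    "sym_diff S {j, i} = sym_diff S {i, j}"
    using ij(3) by auto
  note flips = label_flip[OF c S] label_flip[OF c sub(1)] label_flip[OF c sub(2)]
    label_flip[OF c sub(3)]
  define a b a' b' where "a = label c S i" "b = label c (sym_diff S {i}) j"
    "a' = label c (sym_diff S {i, j}) i" "b' = label c (sym_diff S {j}) j"
  note d = this
  have R: "(a, b, a', b') \<in> R i j" using sq unfolding square_at_def d .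
  have i1: "label c (sym_diff S {i}) i = \<iota> i a" "label c S j = \<iota> j b'"
    "label c (sym_diff S {j}) i = \<iota> i a'" "label c (sym_diff S {i, j}) j = \<iota> j b"
    using flips(1)[OF ij(1)] flips(3)[OF ij(2)] flips(4)[OF ij(1)] flips(2)[OF ij(2)]
    unfolding eqs d by simp_all
  have "(\<iota> i a, \<iota> j b', \<iota> i a', \<iota> j b) \<in> R i j" "(\<iota> i a', \<iota> j b, \<iota> i a, \<iota> j b') \<in> R i j"
    using C1 R ij unfolding C1_def by blast+
  then show "square_at c (sym_diff S {i}) i j" "square_at c (sym_diff S {j}) i j"
    unfolding square_at_def eqs i1 d(1-4)[symmetric] by simp_all
  have "R j i = (\<lambda>(a, b, a', b'). (\<iota> j b', \<iota> i a', \<iota> j b, \<iota> i a)) ` R i j"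
    using squares ij unfolding square_sets_def by blast
  then have "(\<iota> j b', \<iota> i a', \<iota> j b, \<iota> i a) \<in> R j i" using R by force
  then show "square_at c S j i" unfolding square_at_def eqs i1 .
qed

lemma square_at_flip_iff:
  assumes c: "c \<in> cubes" and S: "S \<subseteq> K" and ij: "i \<in> K" "j \<in> K" "i \<noteq> j"
  shows "square_at c (sym_diff S {i}) i j \<longleftrightarrow> square_at c S i j"
proof -
  have sub: "sym_diff S {i} \<subseteq> K" using S ij by auto
  have eq: "sym_diff (sym_diff S {i}) {i} = S" by auto
  show ?thesis
    using square_at_flip(1)[OF c S ij] square_at_flip(1)[OF c sub ij] unfolding eq by blast
qed

lemma cube_squares:
  assumes c: "c \<in> cubes" and L: "L \<subseteq> J"
  shows "j \<in> J - L \<Longrightarrow>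
      (edge_u c L, edge_v c L j, edge_u c (insert j L), edge_w c L j) \<in> R p j"
    and "i \<in> J - L \<Longrightarrow> j \<in> J - L \<Longrightarrow> i \<noteq> j \<Longrightarrow>
      (\<iota> i (edge_v c L i), edge_v c L j,
       \<iota> i (edge_w c (insert j L) i), edge_w c (insert i L) j) \<in> R i j"
    and "i \<in> J - L \<Longrightarrow> j \<in> J - L \<Longrightarrow> i \<noteq> j \<Longrightarrow>
      (edge_w c L i, \<iota> j (edge_w c L j),
       edge_v c (insert j L) i, \<iota> j (edge_v c (insert i L) j)) \<in> R i j"
proof -
  have small: "card L < card J" if "j \<in> J - L" for j
  proof (rule psubset_card_mono)
    show "L \<subset> J" using L that by blast
  qed simp
  have "cube_system E \<iota> R p J c"
    using c unfolding pointed_cubes_def cube_extending_def by blast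
  note sq = this[unfolded cube_system_def, THEN conjunct2, THEN conjunct2, THEN conjunct2,
      rule_format, OF conjI, OF L]
  show "j \<in> J - L \<Longrightarrow>
      (edge_u c L, edge_v c L j, edge_u c (insert j L), edge_w c L j) \<in> R p j"
    using sq[OF small, THEN conjunct1, rule_format, of j j]
    by (simp only: Un_insert_right Un_empty_right simp_thms)
  show "i \<in> J - L \<Longrightarrow> j \<in> J - L \<Longrightarrow> i \<noteq> j \<Longrightarrow>
      (\<iota> i (edge_v c L i), edge_v c L j,
       \<iota> i (edge_w c (insert j L) i), edge_w c (insert i L) j) \<in> R i j"
    using sq[OF small, THEN conjunct2, THEN conjunct1, rule_format, of j i j]
    by (simp only: Un_insert_right Un_empty_right simp_thms)
  show "i \<in> J - L \<Longrightarrow> j \<in> J - L \<Longrightarrow> i \<noteq> j \<Longrightarrow>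
      (edge_w c L i, \<iota> j (edge_w c L j),
       edge_v c (insert j L) i, \<iota> j (edge_v c (insert i L) j)) \<in> R i j"
    using sq[OF small, THEN conjunct2, THEN conjunct2, rule_format, of j i j]
    by (simp only: Un_insert_right Un_empty_right simp_thms)
qed

text \<open>
  The tuple in \<open>R p j\<close> given by the cube starts at the vertex of even cardinality, that is at \<open>L\<close> or at
  \<open>insert p L\<close>.
\<close>

lemma square_at_base_direction:
  assumes c: "c \<in> cubes" and L: "L \<subseteq> J" and j: "j \<in> J - L"
  shows "square_at c L p j"
proof -
  have fin: "finite L" "finite (insert j L)" using L by (auto intro: finite_subset)
  have Lp: "p \<notin> L" "j \<noteq> p" "j \<notin> L" "L \<subseteq> K" "insert j L \<subseteq> K" using L j by auto
  have R: "(edge_u c L, edge_v c L j, edge_u c (insert j L), edge_w c L j) \<in> R p j"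
    by (rule cube_squares(1)[OF c L j])
  have dd: "sym_diff L {p} = insert p L" "sym_diff L {p, j} = insert p (insert j L)"
    "sym_diff L {j} = insert j L" "L - {p} = L" "insert p L - {p} = L" "insert j L - {p, j} = L"
    "insert p (insert j L) - {p} = insert j L" "insert j L - {p} = insert j L"
    "insert p (insert j L) - {p, j} = L"
    using Lp by auto
  have inv: "\<iota> j (\<iota> j (edge_w c L j)) = edge_w c L j"
    using inv_inv edge_w_in[OF c L j] j by auto
  have evens: "even (card (insert p L)) \<longleftrightarrow> odd (card L)"
    "even (card (insert j L)) \<longleftrightarrow> odd (card L)"
    "even (card (insert p (insert j L))) \<longleftrightarrow> even (card L)"
    using fin Lp by auto
  show ?thesis
  proof (cases "even (card L)")
    case True
    have "square_at c L p j"
      unfolding square_at_def dd label_def using True Lp R by (simp add: evens dd)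
    then show ?thesis .
  next
    case False
    have "sym_diff (insert p L) {p} = L" "sym_diff (insert p L) {p, j} = insert j L"
      "sym_diff (insert p L) {j} = insert p (insert j L)"
      using Lp by auto
    then have "square_at c (sym_diff L {p}) p j"
      unfolding square_at_def dd label_def using False Lp R by (simp add: evens dd inv)
    then show ?thesis using square_at_flip_iff[OF c Lp(4) base, of j] j by auto
  qed
qed

text \<open>
  The two families of squares in \<open>R i j\<close> given by the cube start at \<open>insert i S\<close>. They belong to the
  two heights of the cube in direction \<open>p\<close>: one family has \<open>card S\<close> odd, the other has \<open>card S\<close> even.
\<close>

lemma square_at_other_directions:
  assumes c: "c \<in> cubes" and S: "S \<subseteq> K" and ij: "i \<in> J - S" "j \<in> J - S" "i \<noteq> j"
  shows "square_at c S i j"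
proof -
  define L where "L = S - {p}"
  have L: "L \<subseteq> J" "i \<in> J - L" "j \<in> J - L" using S ij unfolding L_def by auto
  have R: "(\<iota> i (edge_v c L i), edge_v c L j,
      \<iota> i (edge_w c (insert j L) i), edge_w c (insert i L) j) \<in> R i j"
    "(edge_w c L i, \<iota> j (edge_w c L j),
      edge_v c (insert j L) i, \<iota> j (edge_v c (insert i L) j)) \<in> R i j"
    using cube_squares(2,3)[OF c L(1)] L(2,3) ij(3) by blast+
  have dd: "sym_diff (sym_diff S {i}) {i} = S" "sym_diff (sym_diff S {i}) {i, j} = insert j S"
    "sym_diff (sym_diff S {i}) {j} = insert i (insert j S)" "sym_diff S {i} = insert i S"
    and ddL: "S - {p} = L" "insert i S - {p, i} = L" "insert j S - {p} = insert j L"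
    "insert i (insert j S) - {p, j} = insert i L"
    using ij unfolding L_def by auto
  have fin: "finite S" using S by (rule finite_subset) simp
  have evens: "even (card (insert i S)) \<longleftrightarrow> odd (card S)"
    "even (card (insert j S)) \<longleftrightarrow> odd (card S)"
    "even (card (insert i (insert j S))) \<longleftrightarrow> even (card S)"
    using fin ij by auto
  have neq: "i \<noteq> p" "j \<noteq> p" "i \<notin> S" "j \<notin> S" "i \<in> K" "j \<in> K" using ij by auto
  have "square_at c (sym_diff S {i}) i j"
    unfolding square_at_def dd label_def using R neq ij(3) by (simp add: evens ddL)
  then show ?thesis using square_at_flip_iff[OF c S neq(5,6) ij(3)] by simp
qed

lemma square_at_vertex:
  assumes c: "c \<in> cubes" and S: "S \<subseteq> K" and ij: "i \<in> K" "j \<in> K" "i \<noteq> j"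
  shows "square_at c S i j"
proof -
  let ?T = "S - {i, j}"
  have T: "?T \<subseteq> K" using S by auto
  have T_sq: "square_at c ?T i j"
  proof (cases "i = p \<or> j = p")
    case True
    have "?T \<subseteq> J" "i \<noteq> p \<Longrightarrow> i \<in> J - ?T" "j \<noteq> p \<Longrightarrow> j \<in> J - ?T"
      using True S ij by auto
    then show ?thesis
      using True ij square_at_base_direction[OF c]
        square_at_flip(3)[OF c T ij(2,1) ij(3)[symmetric]] by metis
  next
    case False
    then show ?thesis using square_at_other_directions[OF c T] ij by simp
  qed
  define T' where "T' = S - {i}"
  have T': "T' \<subseteq> K" using S unfolding T'_def by auto
  have T'_sq: "square_at c T' i j"
  proof (cases "j \<in> S")
    case True
    then have "T' = sym_diff ?T {j}" unfolding T'_def using ij by auto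
    then show ?thesis using square_at_flip(2)[OF c T ij T_sq] by simp
  next
    case False
    then have "T' = ?T" unfolding T'_def by auto
    then show ?thesis using T_sq by simp
  qed
  show ?thesis
  proof (cases "i \<in> S")
    case True
    then have "S = sym_diff T' {i}" unfolding T'_def by auto
    then show ?thesis using square_at_flip(1)[OF c T' ij T'_sq] by simp
  next
    case False
    then have "S = T'" unfolding T'_def by auto
    then show ?thesis using T'_sq by simp
  qed
qed

text \<open>
  In the square at \<open>S\<close> spanned by the directions \<open>i\<close> and \<open>j\<close>, the walk leaves along \<open>i\<close> and returns along
  \<open>j\<close>, so the two labels at \<open>S\<close> are the first entry and the inverse of the last entry. By C2 these
  entries determine the square.
\<close>

lemma label_step:
  assumes AB: "A \<in> cubes" "B \<in> cubes" and ST: "S \<subseteq> K" "T \<subseteq> K" and ij: "i \<in> K" "j \<in> K"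
    and eq: "label A S i = label B T i" "label A S j = label B T j"
  shows "label A (sym_diff S {i}) j = label B (sym_diff T {i}) j"
proof (cases "i = j")
  case True
  then show ?thesis
    using label_flip[OF AB(1) ST(1) ij(1)] label_flip[OF AB(2) ST(2) ij(1)] eq(1) by simp
next
  case False
  have inj: "inj_on (\<lambda>(a, b, a', b'). (a, b')) (R i j)"
    using C2 ij False unfolding C2_def bij_betw_def by blast
  have "label A (sym_diff S {j}) j = label B (sym_diff T {j}) j"
    using label_flip[OF AB(1) ST(1) ij(2)] label_flip[OF AB(2) ST(2) ij(2)] eq(2) by simp
  then show ?thesis
    using inj_onD[OF inj _ square_at_vertex[OF AB(1) ST(1) ij False, unfolded square_at_def]
        square_at_vertex[OF AB(2) ST(2) ij False, unfolded square_at_def]] eq(1)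
    by simp
qed

text \<open>
  Every entry of the record is itself the label of an edge, read at the vertex where it starts;
  outside its domain the record is fixed by extensionality.
\<close>

lemma label_ext:
  assumes AB: "A \<in> cubes" "B \<in> cubes"
    and eq: "\<And>S i. S \<subseteq> K \<Longrightarrow> i \<in> K \<Longrightarrow> label A S i = label B S i"
  shows "A = B"
proof -
  have fin: "finite L" if "L \<subseteq> J" for L using that by (rule finite_subset) simp
  have u: "edge_u A L = edge_u B L" if L: "L \<subseteq> J" for L
  proof -
    have "p \<notin> L" "L - {p} = L" "insert p L - {p} = L" "L \<subseteq> K" "insert p L \<subseteq> K"
      using L base by auto
    then show ?thesis
      using eq[of L p] eq[of "insert p L" p] base fin[OF L]
      by (cases "even (card L)") (simp_all add: label_def)
  qed
  have vw: "edge_v A L i = edge_v B L i \<and> edge_w A L i = edge_w B L i"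
    if L: "L \<subseteq> J" "i \<in> J - L" for L i
  proof -
    let ?pL = "insert p L"
    have sets: "L - {p} = L" "?pL - {p} = L" "insert i L - {p, i} = L" "insert i ?pL - {p, i} = L"
      using L by auto
    have sub: "L \<subseteq> K" "?pL \<subseteq> K" "insert i L \<subseteq> K" "insert i ?pL \<subseteq> K" and i: "i \<in> K"
      using L base by auto
    have neq: "i \<noteq> p" "p \<notin> L" "i \<notin> L" using L by auto
    show ?thesis
      using eq[OF sub(1) i] eq[OF sub(2) i] eq[OF sub(3) i] eq[OF sub(4) i] neq fin[OF L(1)]
      unfolding label_def sets by (cases "even (card L)") simp_all
  qed
  have types: "edge_u C \<in> Pow J \<rightarrow>\<^sub>E E p"
    "edge_v C \<in> (\<Pi>\<^sub>E L\<in>Pow J. \<Pi>\<^sub>E i\<in>J - L. E i)"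
    "edge_w C \<in> (\<Pi>\<^sub>E L\<in>Pow J. \<Pi>\<^sub>E i\<in>J - L. E i)" if "C \<in> cubes" for C
    using that unfolding pointed_cubes_def cube_extending_def cube_system_def by auto
  have "edge_u A = edge_u B"
    by (rule PiE_ext[OF types(1)[OF AB(1)] types(1)[OF AB(2)]]) (use u in auto)
  moreover have "edge_v A = edge_v B"
  proof (rule PiE_ext[OF types(2)[OF AB(1)] types(2)[OF AB(2)]])
    fix L assume L: "L \<in> Pow J"
    show "edge_v A L = edge_v B L"
      by (rule PiE_ext[OF PiE_mem[OF types(2)[OF AB(1)] L] PiE_mem[OF types(2)[OF AB(2)] L]])
        (use vw L in auto)
  qed
  moreover have "edge_w A = edge_w B"
  proof (rule PiE_ext[OF types(3)[OF AB(1)] types(3)[OF AB(2)]])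
    fix L assume L: "L \<in> Pow J"
    show "edge_w A L = edge_w B L"
      by (rule PiE_ext[OF PiE_mem[OF types(3)[OF AB(1)] L] PiE_mem[OF types(3)[OF AB(2)] L]])
        (use vw L in auto)
  qed
  ultimately show ?thesis by (cases A, cases B) simp
qed

text \<open>
  For \<open>k = 2\<close> a pointed cube is a single square, so the given element of \<open>R p j\<close> already is the cube.
\<close>

lemma extending_exists:
  assumes R: "\<And>j. j \<in> J \<Longrightarrow> (u, v j, u' j, w j) \<in> R p j"
  shows "\<exists>c. cube_extending E \<iota> R p J u v u' w c"
proof (cases "k \<ge> 3")
  case True
  have "card J = k - 1" "k \<in> {2..k}" using base True by auto
  then have "\<exists>!c. cube_extending E \<iota> R p J u v u' w c"
    by (intro C3[OF True, unfolded C3_def, rule_format, OF base, of k J u v u' w]) (simp_all add: R)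
  then show ?thesis by blast
next
  case False
  with dim have "k = 2" by simp
  then have "J = {3 - p}" using base by (auto simp: set_eq_iff) presburger
  then obtain j where J: "J = {j}" ..
  have "j \<in> J" "j \<in> K" "j \<noteq> p" using J by blast+
  then have "R p j \<subseteq> E p \<times> E j \<times> E p \<times> E j"
    by (intro squares[unfolded square_sets_def, rule_format, OF base, THEN conjunct1]) simp_all
  from subsetD[OF this R[OF \<open>j \<in> J\<close>]]
  have mem: "u \<in> E p" "v j \<in> E j" "u' j \<in> E p" "w j \<in> E j" by simp_all
  \<comment> \<open>At \<open>L = J\<close> there is no direction left, and \<open>\<lambda>i. undefined\<close> is the only function on \<open>J - L = {}\<close>.\<close>
  define f where "f x L = (if L = {} then (\<lambda>i. if i = j then x else undefined)
    else if L = {j} then (\<lambda>i. undefined) else undefined)" for x :: 'a and L :: "nat set"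
  define c where "c = \<lparr>edge_u = (\<lambda>L. if L = {} then u else if L = {j} then u' j else undefined),
    edge_v = f (v j), edge_w = f (w j)\<rparr>"
  have f: "f x \<in> (\<Pi>\<^sub>E L\<in>Pow J. \<Pi>\<^sub>E i\<in>J - L. E i)" if "x \<in> E j" for x
    unfolding J f_def using that by (auto simp: PiE_def extensional_def subset_singleton_iff)
  have u: "edge_u c \<in> Pow J \<rightarrow>\<^sub>E E p"
    unfolding J c_def using mem by (auto simp: PiE_def extensional_def subset_singleton_iff)
  have "cube_extending E \<iota> R p J u v u' w c"
    unfolding cube_extending_def cube_system_def
    using u f[OF mem(2)] f[OF mem(4)] R[OF \<open>j \<in> J\<close>] unfolding J
    by (auto simp: c_def f_def)
  then show ?thesis ..
qed

text \<open>
  The vertex \<open>{p}\<close> is the end of the edge labelled \<open>u\<close> and the start of the edges labelled \<open>v\<^sub>j\<close>. By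
  C2 the pair of \<open>u\<close> and \<open>v\<^sub>j\<close> extends to a square in \<open>R p j\<close>, and C3 extends these squares to a cube.
\<close>

lemma fill_corner_label:
  assumes a: "\<And>i. i \<in> K \<Longrightarrow> a i \<in> E i"
  shows "\<exists>c\<in>cubes. \<forall>i\<in>K. label c {p} i = a i"
proof -
  let ?u = "\<iota> p (a p)"
  have "\<exists>u' w. (?u, a j, u', w) \<in> R p j" if j: "j \<in> J" for j
  proof -
    have "bij_betw (\<lambda>(a, b, a', b'). (a, b)) (R p j) (E p \<times> E j)"
      by (rule C2[unfolded C2_def, rule_format, OF base, THEN conjunct1]) (use j in auto)
    then have "(\<lambda>(a, b, a', b'). (a, b)) ` R p j = E p \<times> E j"
      by (rule bij_betw_imp_surj_on)
    moreover have "(?u, a j) \<in> E p \<times> E j" using inv_in[OF base a[OF base]] a j by simp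
    ultimately have "(?u, a j) \<in> (\<lambda>(a, b, a', b'). (a, b)) ` R p j" by simp
    then show ?thesis by auto
  qed
  then obtain u' w where R: "\<And>j. j \<in> J \<Longrightarrow> (?u, a j, u' j, w j) \<in> R p j" by metis
  then obtain c where c: "cube_extending E \<iota> R p J ?u a u' w c"
    using extending_exists[of ?u a u' w] by blast
  then have "c \<in> cubes" using R unfolding pointed_cubes_def by blast
  moreover have "label c {p} i = a i" if "i \<in> K" for i
    using c that inv_inv[OF base a[OF base]] unfolding cube_extending_def label_def by auto
  ultimately show ?thesis by blast
qed

sublocale corner_determined_cubes "{1..k}" E "pointed_cubes k E \<iota> R p" label "{p}"
proof
  show "finite {1..k}" by simp
  show "{p} \<subseteq> {1..k}" using base by simp
qed (fact label_in label_step label_ext fill_corner_label)+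

section \<open>Adjacency in terms of edge labels\<close>

text \<open>
  The adjacency relations on records compare each edge of the common face in one orientation only,
  namely outward from \<open>S\<close>; reversing an edge inverts its label.
\<close>

lemma adjacent_iff_outward:
  assumes AB: "A \<in> cubes" "B \<in> cubes" and i: "i \<in> K"
  shows "adjacent i A B \<longleftrightarrow> (\<forall>S. S \<subseteq> K - {i} \<longrightarrow>
    (\<forall>j\<in>K - insert i S. label A (insert i S) j = label B S j) \<and>
    label A (insert i S) i \<noteq> label B S i)" (is "?l \<longleftrightarrow> ?r")
proof
  assume ?l
  then show ?r unfolding adjacent_def by auto
next
  assume r: ?r
  have "label A (insert i S) j = label B S j" if S: "S \<subseteq> K - {i}" and j: "j \<in> K - {i}" for S j
  proof (cases "j \<in> S")
    case True
    let ?T = "S - {j}"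
    have T: "?T \<subseteq> K - {i}" "?T \<subseteq> K" "insert i ?T \<subseteq> K" "insert j ?T = S"
      "insert j (insert i ?T) = insert i S" "j \<in> K - insert i ?T" "j \<in> K" "j \<notin> ?T"
      "j \<notin> insert i ?T"
      using S True j i by auto
    have "label A (insert i ?T) j = label B ?T j" using r T(1,6) by blast
    then show ?thesis
      using label_insert[OF AB(1) T(3,7,9)] label_insert[OF AB(2) T(2,7,8)] T(4,5) by simp
  next
    case False
    then show ?thesis using r S j by blast
  qed
  then show ?l using r unfolding adjacent_def by blast
qed

lemma adjacent_base_iff:
  assumes AB: "A \<in> cubes" "B \<in> cubes"
  shows "adjacent_base \<iota> p J A B \<longleftrightarrow> adjacent p A B"
proof -
  have key: "(\<forall>j\<in>K - insert p L. label A (insert p L) j = label B L j) \<and>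
      label A (insert p L) p \<noteq> label B L p \<longleftrightarrow>
      edge_u A L \<noteq> \<iota> p (edge_u B L) \<and>
     (\<forall>j\<in>J - L. if even (card L) then edge_v A L j = \<iota> j (edge_w B L j)
                else edge_w A L j = \<iota> j (edge_v B L j))" if L: "L \<subseteq> J" for L
  proof -
    have fin: "finite L" using L by (rule finite_subset) simp
    have sets: "L - {p} = L" "insert p L - {p} = L" "p \<notin> L" "K - insert p L = J - L"
      using L by auto
    have even: "even (card (insert p L)) \<longleftrightarrow> odd (card L)" using fin sets by simp
    have "label A (insert p L) p \<noteq> label B L p \<longleftrightarrow> edge_u A L \<noteq> \<iota> p (edge_u B L)"
      using inv_eq_iff[OF base edge_u_in[OF AB(1) L] edge_u_in[OF AB(2) L]]
      unfolding label_def sets even by auto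
    moreover have "label A (insert p L) j = label B L j \<longleftrightarrow>
        (if even (card L) then edge_v A L j = \<iota> j (edge_w B L j)
         else edge_w A L j = \<iota> j (edge_v B L j))" if j: "j \<in> J - L" for j
    proof -
      have "j \<in> K" "j \<noteq> p" "j \<notin> L" using j by auto
      then show ?thesis
        using inv_eq_iff[OF _ edge_w_in[OF AB(1) L j] edge_v_in[OF AB(2) L j]]
        unfolding label_def sets even by auto
    qed
    ultimately show ?thesis unfolding sets by auto
  qed
  show ?thesis
    unfolding adjacent_base_def adjacent_iff_outward[OF AB base] by (simp only: key cong: imp_cong)
qed

text \<open>
  Each vertex \<open>L\<close> of \<open>adjacent_other\<close> stands for the two vertices \<open>L\<close> and \<open>insert p L\<close> of the geometric
  cube.
\<close>

lemma adjacent_other_iff: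
  assumes AB: "A \<in> cubes" "B \<in> cubes" and i: "i \<in> J"
  shows "adjacent_other \<iota> p J i A B \<longleftrightarrow> adjacent i A B"
proof -
  define P where "P S \<longleftrightarrow> (\<forall>j\<in>K - insert i S. label A (insert i S) j = label B S j) \<and>
    label A (insert i S) i \<noteq> label B S i" for S
  define Q where "Q L \<longleftrightarrow> \<iota> p (edge_u B L) = edge_u A (L \<union> {i}) \<and>
     (\<forall>j\<in>J - (L \<union> {i}). \<iota> j (edge_v B L j) = edge_w A (L \<union> {i}) j \<and>
                         \<iota> j (edge_w B L j) = edge_v A (L \<union> {i}) j) \<and>
     edge_v A L i \<noteq> \<iota> i (edge_v B L i) \<and>
     edge_w A L i \<noteq> \<iota> i (edge_w B L i)" for L
  have PQ: "P L \<and> P (insert p L) \<longleftrightarrow> Q L" if L: "L \<subseteq> J - {i}" for L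
  proof -
    let ?iL = "insert i L" and ?pL = "insert p L" and ?ipL = "insert i (insert p L)"
    have neq: "i \<noteq> p" "p \<notin> L" "i \<notin> L" "i \<in> K" using L i by auto
    have fin: "finite L" using L by (auto intro: finite_subset)
    have LJ: "L \<subseteq> J" "?iL \<subseteq> J" "i \<in> J - L" using L i by auto
    have sets: "L - {p} = L" "?pL - {p} = L" "?iL - {p} = ?iL" "?ipL - {p} = ?iL"
      "?iL - {p, i} = L" "?ipL - {p, i} = L" "L \<union> {i} = ?iL"
      "K - ?iL = insert p (J - ?iL)" "K - ?ipL = J - ?iL"
      using neq base by auto
    have evens: "even (card ?iL) \<longleftrightarrow> odd (card L)" "even (card ?pL) \<longleftrightarrow> odd (card L)"
      "even (card ?ipL) \<longleftrightarrow> even (card L)"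
      using fin neq by auto
    have "label A ?iL p = label B L p \<longleftrightarrow> \<iota> p (edge_u B L) = edge_u A ?iL"
      using inv_eq_iff[OF base edge_u_in[OF AB(1) LJ(2)] edge_u_in[OF AB(2) LJ(1)]]
      unfolding label_def sets evens by auto
    moreover have "(label A ?iL j = label B L j \<and> label A ?ipL j = label B ?pL j) \<longleftrightarrow>
        (\<iota> j (edge_v B L j) = edge_w A ?iL j \<and> \<iota> j (edge_w B L j) = edge_v A ?iL j)"
      if j: "j \<in> J - ?iL" for j
    proof -
      have j': "j \<in> K" "j \<noteq> p" "j \<notin> ?iL" "j \<notin> ?pL" "j \<notin> ?ipL" "j \<notin> L" "j \<in> J - L"
        using j by auto
      note inverses = inv_eq_iff[OF j'(1) edge_w_in[OF AB(1) LJ(2) j] edge_v_in[OF AB(2) LJ(1) j'(7)]]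
        inv_eq_iff[OF j'(1) edge_w_in[OF AB(2) LJ(1) j'(7)] edge_v_in[OF AB(1) LJ(2) j]]
      show ?thesis
      proof (cases "even (card L)")
        case True
        have labels: "label A ?iL j = edge_v A ?iL j" "label B L j = \<iota> j (edge_w B L j)"
          "label A ?ipL j = \<iota> j (edge_w A ?iL j)" "label B ?pL j = edge_v B L j"
          unfolding label_def sets evens using True j'(2-6) by simp_all
        show ?thesis unfolding labels using inverses by metis
      next
        case False
        have labels: "label A ?iL j = \<iota> j (edge_w A ?iL j)" "label B L j = edge_v B L j"
          "label A ?ipL j = edge_v A ?iL j" "label B ?pL j = \<iota> j (edge_w B L j)"
          unfolding label_def sets evens using False j'(2-6) by simp_all
        show ?thesis unfolding labels using inverses by metis
      qed
    qed
    moreover have "(label A ?iL i \<noteq> label B L i \<and> label A ?ipL i \<noteq> label B ?pL i) \<longleftrightarrow>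
        (edge_v A L i \<noteq> \<iota> i (edge_v B L i) \<and> edge_w A L i \<noteq> \<iota> i (edge_w B L i))"
      using inv_eq_iff[OF neq(4) edge_v_in[OF AB(1) LJ(1,3)] edge_v_in[OF AB(2) LJ(1,3)]] neq
      unfolding label_def sets evens by (cases "even (card L)") auto
    ultimately show ?thesis unfolding P_def Q_def sets by blast
  qed
  have "(\<forall>S. S \<subseteq> K - {i} \<longrightarrow> P S) \<longleftrightarrow> (\<forall>L. L \<subseteq> J - {i} \<longrightarrow> P L \<and> P (insert p L))"
  proof (intro iffI allI impI)
    fix L assume "\<forall>S. S \<subseteq> K - {i} \<longrightarrow> P S" "L \<subseteq> J - {i}"
    moreover from this(2) have "L \<subseteq> K - {i}" "insert p L \<subseteq> K - {i}" using base i by auto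
    ultimately show "P L \<and> P (insert p L)" by blast
  next
    fix S assume H: "\<forall>L. L \<subseteq> J - {i} \<longrightarrow> P L \<and> P (insert p L)" and S: "S \<subseteq> K - {i}"
    have "S - {p} \<subseteq> J - {i}" using S by auto
    with H have "P (S - {p})" "P (insert p (S - {p}))" by blast+
    then show "P S" by (cases "p \<in> S") (simp_all add: insert_absorb)
  qed
  moreover have "adjacent i A B \<longleftrightarrow> (\<forall>S. S \<subseteq> K - {i} \<longrightarrow> P S)"
    using adjacent_iff_outward[OF AB, of i] i unfolding P_def by blast
  moreover have "adjacent_other \<iota> p J i A B \<longleftrightarrow> (\<forall>L. L \<subseteq> J - {i} \<longrightarrow> Q L)"
    unfolding adjacent_other_def Q_def ..
  ultimately show ?thesis by (simp only: PQ cong: imp_cong)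
qed

lemma adjacency_matrix_adjacent:
  assumes "i \<in> K" "A \<in> cubes" "B \<in> cubes"
  shows "adjacency_matrix k \<iota> p i A B = (if adjacent i A B then 1 else 0)"
  using adjacent_base_iff[of A B] adjacent_other_iff[of A B i] assms
  unfolding adjacency_matrix_def by auto

lemma unique_common_extension_cubes:
  "unique_common_extension k cubes (adjacency_matrix k \<iota> p)"
proof -
  have one: "adjacency_matrix k \<iota> p i A B = 1 \<longleftrightarrow> adjacent i A B"
    if "i \<in> K" "A \<in> cubes" "B \<in> cubes" for i A B
    using adjacency_matrix_adjacent[OF that] by simp
  show ?thesis
    unfolding unique_common_extension_def
  proof (intro conjI impI ballI)
    fix q r s A Bq Br Bs
    assume *: "q \<in> K" "r \<in> K" "s \<in> K" "q \<noteq> r \<and> q \<noteq> s \<and> r \<noteq> s"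
      and X: "A \<in> cubes" "Bq \<in> cubes" "Br \<in> cubes" "Bs \<in> cubes"
      and adj: "adjacency_matrix k \<iota> p q A Bq = 1 \<and> adjacency_matrix k \<iota> p r A Br = 1 \<and>
        adjacency_matrix k \<iota> p s A Bs = 1"
    show "\<exists>!(Cqr, Cqs, Crs, D). Cqr \<in> cubes \<and> Cqs \<in> cubes \<and> Crs \<in> cubes \<and> D \<in> cubes \<and>
        adjacency_matrix k \<iota> p q Br Cqr = 1 \<and> adjacency_matrix k \<iota> p q Bs Cqs = 1 \<and>
        adjacency_matrix k \<iota> p r Bq Cqr = 1 \<and> adjacency_matrix k \<iota> p r Bs Crs = 1 \<and>
        adjacency_matrix k \<iota> p s Bq Cqs = 1 \<and> adjacency_matrix k \<iota> p s Br Crs = 1 \<and>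
        adjacency_matrix k \<iota> p q Crs D = 1 \<and> adjacency_matrix k \<iota> p r Cqs D = 1 \<and>
        adjacency_matrix k \<iota> p s Cqr D = 1"
      using unique_common_extension_triple[OF X *(1-3)] * adj
      by (simp add: one X cong: conj_cong)
  next
    fix A B C
    assume "k = 2" and X: "A \<in> cubes" "B \<in> cubes" "C \<in> cubes"
      and adj: "adjacency_matrix k \<iota> p 1 A B = 1 \<and> adjacency_matrix k \<iota> p 2 A C = 1"
    then have K: "1 \<in> K" "2 \<in> K" by auto
    show "\<exists>!D. D \<in> cubes \<and> adjacency_matrix k \<iota> p 2 B D = 1 \<and> adjacency_matrix k \<iota> p 1 C D = 1"
      using common_extension_ex1[OF X K] adj
      by (simp add: one[OF K(1)] one[OF K(2)] X del: One_nat_def cong: conj_cong)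
  qed
qed

end

theorem proposition2p18:
  fixes \<Gamma> :: "(nat \<times> 'a) list set monoid"
    and k p :: nat
    and E :: "nat \<Rightarrow> 'a set"
    and \<iota> :: "nat \<Rightarrow> 'a \<Rightarrow> 'a"
    and R :: "nat \<Rightarrow> nat \<Rightarrow> ('a \<times> 'a \<times> 'a \<times> 'a) set"
  assumes "k \<ge> 2"
    and "is_cube_group \<Gamma> k E \<iota> R"
    and "p \<in> {1..k}"
  shows "(\<forall>i\<in>{1..k}. \<forall>j\<in>{1..k}.
            matrices_commute (pointed_cubes k E \<iota> R p)
              (adjacency_matrix k \<iota> p i) (adjacency_matrix k \<iota> p j))
         \<and> unique_common_extension k (pointed_cubes k E \<iota> R p) (adjacency_matrix k \<iota> p)"
proof -
  interpret cube_complex k E \<iota> R p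
    using assms unfolding is_cube_group_def by unfold_locales auto
  show ?thesis
  proof (intro conjI ballI)
    fix i j assume "i \<in> {1..k}" "j \<in> {1..k}"
    then show "matrices_commute (pointed_cubes k E \<iota> R p)
        (adjacency_matrix k \<iota> p i) (adjacency_matrix k \<iota> p j)"
      by (intro adjacency_matrices_commute finite_pointed_cubes[OF edges base]
          adjacency_matrix_adjacent)
  qed (rule unique_common_extension_cubes)
qed

end
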